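(* Let $s\ge1$, $k\ge s$, and let $\mathcal F=\mathcal F(L,L_0,S,d_{L+1},\dots,d_{L+L_0},\mathrm{ReLU},\mathrm{ReLU}^k,M,\mathcal S)$ be the CNN function space of the context, with hybrid activation functions $\sigma^{(l)}=\mathrm{ReLU}$ for $l\ne L+1$ and $\sigma^{(L+1)}=\mathrm{ReLU}^k$, kernel sizes $S^{(l)}\equiv S$, layer widths $d_l$, and total number of free parameters $\mathcal S$. Then for every multi-index $\alpha$ with $|\alpha|\le s$, \[ \mathrm{VCDim}(\mathrm{sgn}(D^\alpha\mathcal F))\lesssim \mathcal S(L+L_0)\log\Big(k(L+L_0)\cdot\max\{d_l: l\in\{1,\dots,L+L_0\}\}\Big). \]
   Context: $A\lesssim B$ means $A\le CB$ for a constant $C>0$ independent of the network parameters. $\mathrm{sgn}(t)=\mathbf 1_{t>0}$; for a class $\mathcal G$ of real functions on $\mathcal X$, $\mathrm{sgn}(\mathcal G)=\{\mathrm{sgn}(g):g\in\mathcal G\}$, and $\mathrm{VCDim}(\mathrm{sgn}(\mathcal G))$ is the size of the largest finite $X\subset\mathcal X$ such that $\#\{\mathrm{sgn}(g)|_X: g\in\mathcal G\}=2^{|X|}$. For a multi-index $\alpha\in\mathbb Z^d_{\ge0}$, $D^\alpha=\partial^{|\alpha|}/\partial x_1^{\alpha_1}\cdots\partial x_d^{\alpha_d}$ and $D^\alpha\mathcal F=\{D^\alpha u:\mathbb S^{d-1}\to\mathbb R\mid u\in\mathcal F\}$, where $\mathbb S^{d-1}$ is the unit sphere of $\mathbb R^d$,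 $d\ge2$. Here $D^\alpha u$ is the partial derivative of the network function on $\mathbb R^d$, computed pointwise by the chain rule with the convention $\mathrm{ReLU}'(t)=\mathrm{sgn}(t)$ (and $\frac{d^j}{dt^j}\mathrm{ReLU}^k(t)=k(k-1)\cdots(k-j+1)\,t^{k-j}\,\mathrm{sgn}(t)$ for $1\le j\le k$, and $\mathrm{sgn}$ treated as having zero derivative), restricted to the sphere. CNN space. $\mathrm{ReLU}(t)=\max\{t,0\}$, $\mathrm{ReLU}^k(t)=\max\{t,0\}^k$, applied entrywise. With kernel size $S\ge3$, put $d_0=d$, $d_l=d_{l-1}+S-1$ ($1\le l\le L$), $F^{(0)}(x)=x$, and for $1\le l\le L$ \[F^{(l)}(x)=\mathrm{ReLU}\Big(\big(\textstyle\sum_{j=1}^{d_{l-1}}w^{(l)}_{i-j}(F^{(l-1)}(x))_j\big)_{i=1}^{d_l}-b^{(l)}\Big),\] where $w^{(l)}:\mathbb Z\to\mathbb R$ is supported on $\{0,\dots,S-1\}$ and $b^{(l)}\in\mathbb R^{d_l}$. Downsampling: $\mathcal D(z)=(z_{id})_{i=1}^{\lfloor d_L/d\rfloor}$ for $z\in\mathbb R^{d_L}$. Fully connected layers: $F^{(L+1)}=\mathrm{ReLU}^k(W^{(L+1)}\mathcal D(F^{(L)})-b^{(L+1)})\in\mathbb R^{d_{L+1}}$; $F^{(l)}=\mathrm{ReLU}(W^{(l)}F^{(l-1)}-b^{(l)})\in\mathbb R^{d_l}$ for $L+2\le l\le L+L_0$; output $F^{(L+L_0+1)}=W^{(L+L_0+1)}\cdot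 F^{(L+L_0)}-b^{(L+L_0+1)}\in\mathbb R$. The space $\mathcal F(L,L_0,S,d_{L+1},\dots,d_{L+L_0},\mathrm{ReLU},\mathrm{ReLU}^k,M,\mathcal S)$ consists of all outputs $F^{(L+L_0+1)}:\mathbb S^{d-1}\to\mathbb R$ of such networks having at most $\mathcal S$ free parameters and satisfying $\max_{|\alpha|\le s}\|D^\alpha F^{(L+L_0+1)}\|_\infty\le M$ on $\mathbb S^{d-1}$. Free parameters are counted with sparsity and sharing: the architecture includes a fixed pattern in which every weight/bias entry is either fixed to $0$ or equal to a prescribed coordinate of a parameter vector $\theta$, and the number of free parameters is the number of coordinates of $\theta$. *)

theory Defs
  imports "HOL-Analysis.Analysis" "HOL-Library.FuncSet" "HOL-Library.Extended_Real"
begin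

section \<open>Formal expressions and their derivatives\<close>

text \<open>
  The derivatives of a ReLU network are taken by the chain rule with a convention at the kinks.
  They therefore depend on the way the function is written down and not only on the function,
  so networks are represented as expressions. A point \<open>(x\<^sub>1, \<dots>, x\<^sub>d)\<close> of \<open>d\<close>-space is a function
  \<open>nat \<Rightarrow> real\<close>, read at the indices \<open>1..d\<close>.
  The expression \<open>Act k j e\<close> stands for the \<open>j\<close>-th derivative of \<open>ReLU\<^sup>k\<close>, applied to \<open>e\<close>.
\<close>

datatype expr =
    Coord nat
  | Param nat
  | Const real
  | Add expr expr
  | Sub expr expr
  | Mul expr expr
  | Act nat nat expr

text \<open>The sign function with values in \<open>{0, 1}\<close>, unlike the library function \<open>sgn\<close>.\<close>

definition step :: "real \<Rightarrow> real" where
  "step t = (if t > 0 then 1 else 0)"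

definition relu :: "real \<Rightarrow> real" where
  "relu t = max t 0"

text \<open>For \<open>j > k\<close> the product contains the factor \<open>k - k = 0\<close>: \<open>step\<close> has zero derivative.\<close>

definition relu_pow_deriv :: "nat \<Rightarrow> nat \<Rightarrow> real \<Rightarrow> real" where
  "relu_pow_deriv k j t =
     (if j = 0 then relu t ^ k
      else (\<Prod>i<j. real k - real i) * t ^ (k - j) * step t)"

primrec eval :: "(nat \<Rightarrow> real) \<Rightarrow> (nat \<Rightarrow> real) \<Rightarrow> expr \<Rightarrow> real" where
  "eval \<theta> x (Coord i) = x i"
| "eval \<theta> x (Param p) = \<theta> p"
| "eval \<theta> x (Const c) = c"
| "eval \<theta> x (Add a b) = eval \<theta> x a + eval \<theta> x b"
| "eval \<theta> x (Sub a b) = eval \<theta> x a - eval \<theta> x b"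
| "eval \<theta> x (Mul a b) = eval \<theta> x a * eval \<theta> x b"
| "eval \<theta> x (Act k j a) = relu_pow_deriv k j (eval \<theta> x a)"

primrec pd :: "nat \<Rightarrow> expr \<Rightarrow> expr" where
  "pd i (Coord j) = Const (if i = j then 1 else 0)"
| "pd i (Param p) = Const 0"
| "pd i (Const c) = Const 0"
| "pd i (Add a b) = Add (pd i a) (pd i b)"
| "pd i (Sub a b) = Sub (pd i a) (pd i b)"
| "pd i (Mul a b) = Add (Mul (pd i a) b) (Mul a (pd i b))"
| "pd i (Act k j a) = Mul (Act k (Suc j) a) (pd i a)"

text \<open>Multi-indices are read at the indices \<open>1..d\<close> only.\<close>

definition order_mi :: "nat \<Rightarrow> (nat \<Rightarrow> nat) \<Rightarrow> nat" where
  "order_mi d \<alpha> = (\<Sum>i = 1..d. \<alpha> i)"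

definition deriv_mi :: "nat \<Rightarrow> (nat \<Rightarrow> nat) \<Rightarrow> expr \<Rightarrow> expr" where
  "deriv_mi d \<alpha> e = foldr (\<lambda>i. pd i ^^ \<alpha> i) [1..<Suc d] e"

primrec esum :: "(nat \<Rightarrow> expr) \<Rightarrow> nat \<Rightarrow> expr" where
  "esum f 0 = Const 0"
| "esum f (Suc n) = Add (esum f n) (f (Suc n))"

lemma eval_esum: "eval \<theta> x (esum f n) = (\<Sum>j = 1..n. eval \<theta> x (f j))"
  by (induction n) auto

text \<open>Away from the kinks the formal derivative is the partial derivative.\<close>

primrec no_kink :: "(nat \<Rightarrow> real) \<Rightarrow> (nat \<Rightarrow> real) \<Rightarrow> expr \<Rightarrow> bool" where
  "no_kink \<theta> x (Coord i) \<longleftrightarrow> True"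
| "no_kink \<theta> x (Param p) \<longleftrightarrow> True"
| "no_kink \<theta> x (Const c) \<longleftrightarrow> True"
| "no_kink \<theta> x (Add a b) \<longleftrightarrow> no_kink \<theta> x a \<and> no_kink \<theta> x b"
| "no_kink \<theta> x (Sub a b) \<longleftrightarrow> no_kink \<theta> x a \<and> no_kink \<theta> x b"
| "no_kink \<theta> x (Mul a b) \<longleftrightarrow> no_kink \<theta> x a \<and> no_kink \<theta> x b"
| "no_kink \<theta> x (Act k j a) \<longleftrightarrow> no_kink \<theta> x a \<and> eval \<theta> x a \<noteq> 0"

lemma relu_pow_deriv_has_derivative:
  assumes "t \<noteq> 0" "k \<ge> 1"
  shows "(relu_pow_deriv k j has_real_derivative relu_pow_deriv k (Suc j) t) (at t)"
proof (cases "t > 0")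
  case True
  have eq: "relu_pow_deriv k j u = (\<Prod>i<j. real k - real i) * u ^ (k - j)" if "u > 0" for u
    using that by (auto simp: relu_pow_deriv_def relu_def step_def)
  have "((\<lambda>u. (\<Prod>i<j. real k - real i) * u ^ (k - j)) has_real_derivative
      (\<Prod>i<j. real k - real i) * (real (k - j) * t ^ (k - Suc j))) (at t)"
    by (auto intro!: derivative_eq_intros)
  moreover have "(\<Prod>i<j. real k - real i) * (real (k - j) * t ^ (k - Suc j))
      = relu_pow_deriv k (Suc j) t"
  proof (cases "j \<le> k")
    case True
    then show ?thesis using \<open>t > 0\<close>
      by (auto simp: relu_pow_deriv_def step_def of_nat_diff)
  next
    case False
    then have "(\<Prod>i<j. real k - real i) = 0"
      by (subst prod_zero_iff) auto
    then show ?thesis by (auto simp: relu_pow_deriv_def)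
  qed
  ultimately have "((\<lambda>u. (\<Prod>i<j. real k - real i) * u ^ (k - j)) has_real_derivative
      relu_pow_deriv k (Suc j) t) (at t)" by simp
  then show ?thesis
    by (rule has_field_derivative_transform_within_open[where S = "{0<..}"]) (use True eq in simp_all)
next
  case False
  then have t: "t < 0" using assms by auto
  have eq: "relu_pow_deriv k j u = 0" if "u < 0" for u
    using that assms(2) by (auto simp: relu_pow_deriv_def relu_def step_def)
  have "((\<lambda>u. 0) has_real_derivative relu_pow_deriv k (Suc j) t) (at t)"
    using t by (auto simp: relu_pow_deriv_def step_def)
  then show ?thesis
    by (rule has_field_derivative_transform_within_open[where S = "{..<0}"]) (use t eq in simp_all)
qed

primrec pos_exps :: "expr \<Rightarrow> bool" where
  "pos_exps (Coord i) \<longleftrightarrow> True"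
| "pos_exps (Param p) \<longleftrightarrow> True"
| "pos_exps (Const c) \<longleftrightarrow> True"
| "pos_exps (Add a b) \<longleftrightarrow> pos_exps a \<and> pos_exps b"
| "pos_exps (Sub a b) \<longleftrightarrow> pos_exps a \<and> pos_exps b"
| "pos_exps (Mul a b) \<longleftrightarrow> pos_exps a \<and> pos_exps b"
| "pos_exps (Act k j a) \<longleftrightarrow> pos_exps a \<and> k \<ge> 1"

lemma pd_correct:
  assumes "no_kink \<theta> x e" "pos_exps e"
  shows "((\<lambda>t. eval \<theta> (x(i := t)) e) has_real_derivative eval \<theta> x (pd i e)) (at (x i))"
  using assms
proof (induction e)
  case (Act k j a)
  have "(relu_pow_deriv k j has_real_derivative relu_pow_deriv k (Suc j) (eval \<theta> x a))
      (at (eval \<theta> (x(i := x i)) a))"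
    using Act.prems relu_pow_deriv_has_derivative by simp
  then have "((\<lambda>t. relu_pow_deriv k j (eval \<theta> (x(i := t)) a)) has_real_derivative
      relu_pow_deriv k (Suc j) (eval \<theta> x a) * eval \<theta> x (pd i a)) (at (x i))"
    by (rule DERIV_chain2) (use Act in simp)
  then show ?case by (simp only: eval.simps pd.simps)
qed (auto intro!: derivative_eq_intros)

section \<open>The networks\<close>

text \<open>
  The positions of the weights and biases: \<open>Kernel l t\<close> is \<open>w\<^sup>(\<^sup>l\<^sup>)\<^sub>t\<close>, \<open>Weight l i j\<close> is \<open>W\<^sup>(\<^sup>l\<^sup>)\<^sub>i\<^sub>j\<close>, and
  \<open>Bias l i\<close> is \<open>b\<^sup>(\<^sup>l\<^sup>)\<^sub>i\<close>. The output layer has the single row \<open>i = 1\<close>.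
\<close>

datatype slot = Kernel nat nat | Weight nat nat nat | Bias nat nat

text \<open>
  The value \<open>sharing A z = None\<close> fixes the entry \<open>z\<close> to \<open>0\<close>, and \<open>sharing A z = Some p\<close> makes it
  equal to the coordinate \<open>p < num_params A\<close> of the parameter vector. A coordinate need not be
  used, so an architecture with fewer parameters is covered by every larger \<open>num_params\<close>.
  The field \<open>fc_width\<close> is read at the layers \<open>L + 1, \<dots>, L + L\<^sub>0\<close> only.
\<close>

record cnn_arch =
  input_dim :: nat
  kernel_size :: nat
  conv_depth :: nat
  fc_depth :: nat
  fc_width :: "nat \<Rightarrow> nat"
  relu_exp :: nat
  num_params :: nat
  sharing :: "slot \<Rightarrow> nat option"

definition cnn_arch_wf :: "cnn_arch \<Rightarrow> bool" where
  "cnn_arch_wf A \<longleftrightarrow>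
     input_dim A \<ge> 2 \<and> kernel_size A \<ge> 3 \<and> conv_depth A \<ge> 1 \<and> fc_depth A \<ge> 1 \<and>
     (\<forall>l\<in>{conv_depth A + 1..conv_depth A + fc_depth A}. fc_width A l \<ge> 1) \<and>
     (\<forall>z p. sharing A z = Some p \<longrightarrow> p < num_params A)"

primrec width :: "cnn_arch \<Rightarrow> nat \<Rightarrow> nat" where
  "width A 0 = input_dim A"
| "width A (Suc l) =
     (if Suc l \<le> conv_depth A then width A l + kernel_size A - 1 else fc_width A (Suc l))"

definition entry :: "cnn_arch \<Rightarrow> slot \<Rightarrow> expr" where
  "entry A z = (case sharing A z of None \<Rightarrow> Const 0 | Some p \<Rightarrow> Param p)"

definition kernel :: "cnn_arch \<Rightarrow> nat \<Rightarrow> int \<Rightarrow> expr" where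
  "kernel A l t = (if 0 \<le> t \<and> t < int (kernel_size A) then entry A (Kernel l (nat t)) else Const 0)"

definition conv :: "cnn_arch \<Rightarrow> nat \<Rightarrow> (nat \<Rightarrow> expr) \<Rightarrow> nat \<Rightarrow> expr" where
  "conv A l z i =
     Sub (esum (\<lambda>j. Mul (kernel A l (int i - int j)) (z j)) (width A (l - 1))) (entry A (Bias l i))"

definition affine :: "cnn_arch \<Rightarrow> nat \<Rightarrow> nat \<Rightarrow> (nat \<Rightarrow> expr) \<Rightarrow> nat \<Rightarrow> expr" where
  "affine A l n z i = Sub (esum (\<lambda>j. Mul (entry A (Weight l i j)) (z j)) n) (entry A (Bias l i))"

text \<open>The expression \<open>layer A l i\<close> is the \<open>i\<close>-th component of \<open>F\<^sup>(\<^sup>l\<^sup>)\<close>, for \<open>1 \<le> i \<le> width A l\<close>.\<close>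

primrec layer :: "cnn_arch \<Rightarrow> nat \<Rightarrow> nat \<Rightarrow> expr" where
  "layer A 0 = Coord"
| "layer A (Suc l) = (\<lambda>i.
     if Suc l \<le> conv_depth A then
       Act 1 0 (conv A (Suc l) (layer A l) i)
     else if l = conv_depth A then
       Act (relu_exp A) 0
         (affine A (Suc l) (width A l div input_dim A) (\<lambda>j. layer A l (j * input_dim A)) i)
     else
       Act 1 0 (affine A (Suc l) (width A l) (layer A l) i))"

definition cnn_output :: "cnn_arch \<Rightarrow> expr" where
  "cnn_output A =
     (let l = conv_depth A + fc_depth A in affine A (Suc l) (width A l) (layer A l) 1)"

definition entry_val :: "cnn_arch \<Rightarrow> (nat \<Rightarrow> real) \<Rightarrow> slot \<Rightarrow> real" where
  "entry_val A \<theta> z = (case sharing A z of None \<Rightarrow> 0 | Some p \<Rightarrow> \<theta> p)"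

lemma eval_entry: "eval \<theta> x (entry A z) = entry_val A \<theta> z"
  by (simp add: entry_def entry_val_def split: option.split)

text \<open>The expressions compute the layers of the network.\<close>

lemma eval_conv_layer:
  assumes "Suc l \<le> conv_depth A"
  shows "eval \<theta> x (layer A (Suc l) i) =
    relu ((\<Sum>j = 1..width A l.
        (if 0 \<le> int i - int j \<and> int i - int j < int (kernel_size A)
         then entry_val A \<theta> (Kernel (Suc l) (nat (int i - int j))) else 0) * eval \<theta> x (layer A l j))
      - entry_val A \<theta> (Bias (Suc l) i))"
  using assms
  by (auto simp: conv_def kernel_def eval_esum eval_entry relu_pow_deriv_def
      intro!: arg_cong[of _ _ relu] sum.cong)

lemma eval_first_fc_layer:
  assumes "l = conv_depth A"
  shows "eval \<theta> x (layer A (Suc l) i) =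
    relu ((\<Sum>j = 1..width A l div input_dim A.
        entry_val A \<theta> (Weight (Suc l) i j) * eval \<theta> x (layer A l (j * input_dim A)))
      - entry_val A \<theta> (Bias (Suc l) i)) ^ relu_exp A"
  using assms by (simp add: affine_def eval_esum eval_entry relu_pow_deriv_def)

lemma eval_fc_layer:
  assumes "l > conv_depth A"
  shows "eval \<theta> x (layer A (Suc l) i) =
    relu ((\<Sum>j = 1..width A l. entry_val A \<theta> (Weight (Suc l) i j) * eval \<theta> x (layer A l j))
      - entry_val A \<theta> (Bias (Suc l) i))"
  using assms by (simp add: affine_def eval_esum eval_entry relu_pow_deriv_def)

lemma eval_cnn_output:
  assumes "l = conv_depth A + fc_depth A"
  shows "eval \<theta> x (cnn_output A) =
    (\<Sum>j = 1..width A l. entry_val A \<theta> (Weight (Suc l) 1 j) * eval \<theta> x (layer A l j))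
      - entry_val A \<theta> (Bias (Suc l) 1)"
  using assms by (simp add: cnn_output_def Let_def affine_def eval_esum eval_entry)

section \<open>The function classes on the sphere\<close>

text \<open>
  The coordinates outside \<open>1..d\<close> are set to \<open>0\<close>, so that distinct elements are distinct points.
\<close>

definition unit_sphere :: "nat \<Rightarrow> (nat \<Rightarrow> real) set" where
  "unit_sphere d = {x. (\<forall>i. i \<notin> {1..d} \<longrightarrow> x i = 0) \<and> (\<Sum>i = 1..d. (x i)\<^sup>2) = 1}"

definition cnn_deriv :: "cnn_arch \<Rightarrow> (nat \<Rightarrow> nat) \<Rightarrow> (nat \<Rightarrow> real) \<Rightarrow> (nat \<Rightarrow> real) \<Rightarrow> real" where
  "cnn_deriv A \<alpha> \<theta> x = eval \<theta> x (deriv_mi (input_dim A) \<alpha> (cnn_output A))"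

definition admissible :: "cnn_arch \<Rightarrow> nat \<Rightarrow> real \<Rightarrow> (nat \<Rightarrow> real) set" where
  "admissible A s M =
     {\<theta>. \<forall>\<beta>. order_mi (input_dim A) \<beta> \<le> s \<longrightarrow>
           (\<forall>x\<in>unit_sphere (input_dim A). \<bar>cnn_deriv A \<beta> \<theta> x\<bar> \<le> M)}"

text \<open>
  The class of all derivatives \<open>D\<^sup>\<alpha> u\<close>, where \<open>u\<close> is in the network space; for \<open>\<alpha> = 0\<close> it is the
  network space itself.
\<close>

definition cnn_deriv_class :: "cnn_arch \<Rightarrow> nat \<Rightarrow> real \<Rightarrow> (nat \<Rightarrow> nat) \<Rightarrow> ((nat \<Rightarrow> real) \<Rightarrow> real) set" where
  "cnn_deriv_class A s M \<alpha> =
     (\<lambda>\<theta>. restrict (cnn_deriv A \<alpha> \<theta>) (unit_sphere (input_dim A))) ` admissible A s M"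

section \<open>Vapnik--Chervonenkis dimension\<close>

definition step_class :: "('a \<Rightarrow> real) set \<Rightarrow> ('a \<Rightarrow> real) set" where
  "step_class G = (\<lambda>g x. step (g x)) ` G"

text \<open>For a class of functions on \<open>D\<close> with values in \<open>{0, 1}\<close>.\<close>

definition vc_dim :: "'a set \<Rightarrow> ('a \<Rightarrow> real) set \<Rightarrow> enat" where
  "vc_dim D H =
     Sup {enat (card X) | X. finite X \<and> X \<subseteq> D \<and> card ((\<lambda>h. restrict h X) ` H) = 2 ^ card X}"

end

theory Submission
  imports Defs "HOL-Computational_Algebra.Polynomial"
begin

text \<open>
  Fix \<open>m\<close> points. As the parameter vector \<open>\<theta>\<close> varies, the value of a network, or of one of its
  formal derivatives, at such a point is a piecewise polynomial in \<open>\<theta>\<close>, and the piece is selected by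
  the signs of the pre-activations. The proof counts the sign patterns layer by layer: as long as
  the signs in the earlier layers are frozen, the pre-activations of the next layer at the \<open>m\<close> points
  are at most \<open>m W\<close> honest polynomials in \<open>\<theta>\<close>, where \<open>W\<close> is the largest width, so the number of
  patterns grows in each layer at most by the factor given by the number of sign patterns which \<open>m W\<close> polynomials can
  have (\<open>card_layered_gate_patterns\<close>). Differentiation fits into this scheme without cost: it
  introduces no new sign conditions (\<open>gates_pd\<close>) and does not raise the degree (\<open>deg_pd\<close>), so the
  derivative of the output is one more layer, consisting of a single function.

  The number of sign patterns of \<open>n\<close> polynomials of total degree at most \<open>D\<close> in \<open>p\<close> variables is at most
  \<open>(p (2 n D + 4) + 1)\<^sup>p\<close> (\<open>card_sign_patterns_of_polyfuns\<close>), a weak form of Warren's theorem. Every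
  pattern has a bounded open cell in which the square \<open>h\<close> of the product of the polynomials is positive
  and on whose boundary \<open>h\<close> vanishes; maximising \<open>h\<close> plus a small linear form shows that on each cell
  the gradient of \<open>h\<close> attains all small values. So for every small \<open>y\<close> the system \<open>\<nabla>h = y\<close> has a
  solution in each cell, and the number of cells is bounded by a weak Bezout theorem
  (\<open>card_disjoint_sets_mapped_over_box\<close>): if \<open>g\<close> is a polynomial that separates the cells, then the
  gradient and the powers of \<open>g\<close> satisfy a nontrivial polynomial relation because of the number of
  monomials, and for almost all small \<open>y\<close> this relation specialises to a nonzero univariate polynomial which
  has the value of \<open>g\<close> at each of the solutions as a root.

  Let \<open>\<Lambda> = L + L\<^sub>0\<close>. A shattered set of size \<open>m\<close> satisfies
  \<open>2\<^sup>m \<le> (p (2 m W k (\<Lambda> + 1) + 4) + 1) ^ (p (\<Lambda> + 1))\<close>, where \<open>p\<close> is the number of parameters that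
  occur in the network. Solving for \<open>m\<close> gives \<open>m \<lesssim> p \<Lambda> log (p k \<Lambda> W)\<close>, and since a network of this
  size has only polynomially many weights in \<open>\<Lambda>\<close> and \<open>W\<close>, the factor \<open>p\<close> inside the logarithm is
  absorbed (\<open>shattering_inequality_solved\<close>).
\<close>

section \<open>Polynomial functions\<close>

text \<open>
  A predicate for polynomial functions of total degree at most \<open>n\<close> in the variables with index in \<open>I\<close>.
  Functions rather than coefficient tables suffice, since only values, degrees and restrictions to
  lines are used; and the variable set is an argument because the number of parameters of a network
  is not fixed.
\<close>

inductive polyfun :: "nat set \<Rightarrow> nat \<Rightarrow> ((nat \<Rightarrow> real) \<Rightarrow> real) \<Rightarrow> bool" for I where
  const: "polyfun I n (\<lambda>x. c)"
| var: "i \<in> I \<Longrightarrow> polyfun I (Suc n) (\<lambda>x. x i)"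
| add: "polyfun I n f \<Longrightarrow> polyfun I n g \<Longrightarrow> polyfun I n (\<lambda>x. f x + g x)"
| mult: "polyfun I m f \<Longrightarrow> polyfun I n g \<Longrightarrow> polyfun I (m + n) (\<lambda>x. f x * g x)"

lemma polyfun_mono:
  assumes "polyfun I m f" "m \<le> n"
  shows "polyfun I n f"
  using polyfun.mult[OF polyfun.const[of I "n - m" 1] assms(1)] assms(2) by simp

lemma polyfun_cmult: "polyfun I n f \<Longrightarrow> polyfun I n (\<lambda>x. c * f x)"
  using polyfun.mult[OF polyfun.const[of I 0 c]] by fastforce

lemma polyfun_uminus: "polyfun I n f \<Longrightarrow> polyfun I n (\<lambda>x. - f x)"
  using polyfun.mult[OF polyfun.const[of I 0 "-1"]] by fastforce

lemma polyfun_diff: "polyfun I n f \<Longrightarrow> polyfun I n g \<Longrightarrow> polyfun I n (\<lambda>x. f x - g x)"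
  using polyfun.add[OF _ polyfun_uminus] by fastforce

lemma polyfun_power: "polyfun I n f \<Longrightarrow> polyfun I (k * n) (\<lambda>x. f x ^ k)"
  by (induction k) (auto intro: polyfun.const polyfun.mult)

lemma polyfun_sum:
  assumes "\<And>j. j \<in> J \<Longrightarrow> polyfun I n (f j)"
  shows "polyfun I n (\<lambda>x. \<Sum>j\<in>J. f j x)"
  using assms by (induction J rule: infinite_finite_induct) (auto intro: polyfun.const polyfun.add)

lemma polyfun_prod:
  assumes "\<And>j. j \<in> J \<Longrightarrow> polyfun I n (f j)"
  shows "polyfun I (card J * n) (\<lambda>x. \<Prod>j\<in>J. f j x)"
  using assms
  by (induction J rule: infinite_finite_induct) (auto intro: polyfun.const polyfun.mult)

lemma polyfun_continuous_on: "polyfun I n f \<Longrightarrow> continuous_on A f"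
  by (induction rule: polyfun.induct)
    (auto intro!: continuous_intros intro: continuous_on_subset[OF continuous_on_product_coordinates])

lemma polyfun_cong:
  "polyfun I n f \<Longrightarrow> (\<And>i. i \<in> I \<Longrightarrow> x i = y i) \<Longrightarrow> f x = f y"
  by (induction rule: polyfun.induct) auto

lemma polyfun_restrict_to_line:
  "polyfun I n f \<Longrightarrow> \<exists>q. degree q \<le> n \<and> (\<forall>t. f (x(i := t)) = poly q t)"
proof (induction rule: polyfun.induct)
  case (const n c)
  show ?case by (rule exI[of _ "[:c:]"]) simp
next
  case (var j n)
  show ?case
    by (rule exI[of _ "if j = i then [:0, 1:] else [:x j:]"]) simp
next
  case (add n f g)
  then obtain p q where "degree p \<le> n" "\<forall>t. f (x(i := t)) = poly p t"
    "degree q \<le> n" "\<forall>t. g (x(i := t)) = poly q t" by blast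
  then show ?case by (intro exI[of _ "p + q"]) (simp add: degree_add_le del: fun_upd_apply)
next
  case (mult m f n g)
  then obtain p q where "degree p \<le> m" "\<forall>t. f (x(i := t)) = poly p t"
    "degree q \<le> n" "\<forall>t. g (x(i := t)) = poly q t" by blast
  then show ?case
    using degree_mult_le[of p q] by (intro exI[of _ "p * q"]) (auto simp del: fun_upd_apply)
qed

lemma polyfun_partial_derivative:
  "polyfun I n f \<Longrightarrow>
   \<exists>f'. polyfun I n f' \<and> (\<forall>x. ((\<lambda>t. f (x(i := t))) has_real_derivative f' x) (at (x i)))"
proof (induction rule: polyfun.induct)
  case (const n c)
  show ?case by (rule exI[of _ "\<lambda>x. 0"]) (auto intro: polyfun.const)
next
  case (var j n)
  show ?case
    by (rule exI[of _ "\<lambda>x. if j = i then 1 else 0"])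
      (auto intro: polyfun.const simp: fun_upd_def)
next
  case (add n f g)
  then obtain f' g' where
    "polyfun I n f'" "\<forall>x. ((\<lambda>t. f (x(i := t))) has_real_derivative f' x) (at (x i))"
    "polyfun I n g'" "\<forall>x. ((\<lambda>t. g (x(i := t))) has_real_derivative g' x) (at (x i))" by blast
  then show ?case
    by (intro exI[of _ "\<lambda>x. f' x + g' x"] conjI allI polyfun.add DERIV_add) blast+
next
  case (mult m f n g)
  then obtain f' g' where *:
    "polyfun I m f'" "\<And>x. ((\<lambda>t. f (x(i := t))) has_real_derivative f' x) (at (x i))"
    "polyfun I n g'" "\<And>x. ((\<lambda>t. g (x(i := t))) has_real_derivative g' x) (at (x i))" by blast
  have "((\<lambda>t. f (x(i := t)) * g (x(i := t))) has_real_derivative f' x * g x + f x * g' x) (at (x i))"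
    for x
    using DERIV_mult[OF *(2)[of x] *(4)[of x]] by (simp add: algebra_simps)
  moreover have "polyfun I (m + n) (\<lambda>x. f' x * g x + f x * g' x)"
    using mult.hyps * by (intro polyfun.add polyfun.mult)
  ultimately show ?case by blast
qed

text \<open>
  Polynomials of degree at most \<open>n\<close> form a space of dimension at most \<open>(n + 1) ^ card I\<close>. This is used
  in the following form, which follows by freeing one variable of the grid after the other.
\<close>

lemma polyfun_vanishes_if_zero_on_grid:
  assumes "finite I" and f: "polyfun I n f" and Y: "finite Y" "card Y > n"
    and zero: "\<And>x. x \<in> PiE I (\<lambda>_. Y) \<Longrightarrow> f x = 0"
  shows "f x = 0"
proof -
  have *: "f x = 0" if "finite J" "J \<subseteq> I" "x \<in> (I - J) \<rightarrow> Y" "x \<in> extensional I" for J x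
    using that
  proof (induction J arbitrary: x rule: finite_induct)
    case empty
    then show ?case using zero by (simp add: PiE_def)
  next
    case (insert j J)
    obtain q where q: "degree q \<le> n" "\<And>t. f (x(j := t)) = poly q t"
      using polyfun_restrict_to_line[OF f] by metis
    have root: "poly q t = 0" if "t \<in> Y" for t
    proof -
      have "f (x(j := t)) = 0"
        by (rule insert.IH) (use insert.prems that in \<open>auto simp: extensional_def\<close>)
      then show ?thesis by (simp add: q)
    qed
    have "q = 0"
    proof (rule ccontr)
      assume "q \<noteq> 0"
      have "card Y \<le> card {t. poly q t = 0}"
        using root by (intro card_mono poly_roots_finite \<open>q \<noteq> 0\<close>) auto
      also have "\<dots> \<le> degree q" by (rule card_poly_roots_bound[OF \<open>q \<noteq> 0\<close>])
      finally show False using q(1) Y(2) by simp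
    qed
    then show ?case using q(2)[of "x j"] by simp
  qed
  have "f x = f (restrict x I)"
    by (rule polyfun_cong[OF f]) simp
  also have "\<dots> = 0" by (rule *[of I]) (use assms in auto)
  finally show ?thesis .
qed

text \<open>
  The grid may lie in an arbitrarily small box, so a polynomial with a nonzero coefficient does not
  vanish identically near the origin.
\<close>

lemma polynomial_coefficients_unique:
  fixes c :: "(nat \<Rightarrow> nat) \<Rightarrow> real"
  assumes "finite I" "finite Y" "card Y \<ge> A"
    and "\<forall>y \<in> I \<rightarrow> Y. (\<Sum>a\<in>PiE I (\<lambda>_. {..<A}). c a * (\<Prod>i\<in>I. y i ^ a i)) = 0"
    and "a \<in> PiE I (\<lambda>_. {..<A})"
  shows "c a = 0"
  using assms(1,4,5)
proof (induction I arbitrary: c a rule: finite_induct)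
  case empty
  then show ?case by auto
next
  case (insert j I)
  let ?S = "PiE I (\<lambda>_. {..<A})"
  define q where "q y = (\<Sum>k<A. monom (\<Sum>a\<in>?S. c (a(j := k)) * (\<Prod>i\<in>I. y i ^ a i)) k)" for y
  have split: "(\<Sum>a\<in>PiE (insert j I) (\<lambda>_. {..<A}). c a * (\<Prod>i\<in>insert j I. y i ^ a i))
      = poly (q y) (y j)" for y
  proof -
    have "(\<Sum>a\<in>PiE (insert j I) (\<lambda>_. {..<A}). c a * (\<Prod>i\<in>insert j I. y i ^ a i))
        = (\<Sum>(k, a)\<in>{..<A} \<times> ?S. c (a(j := k)) * (\<Prod>i\<in>insert j I. y i ^ (a(j := k)) i))"
      using inj_combinator[OF \<open>j \<notin> I\<close>, of "\<lambda>_. {..<A}"]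
      by (subst PiE_insert_eq, subst sum.reindex) (auto simp: case_prod_beta)
    also have "\<dots> = (\<Sum>k<A. \<Sum>a\<in>?S. c (a(j := k)) * (\<Prod>i\<in>insert j I. y i ^ (a(j := k)) i))"
      by (subst sum.cartesian_product) simp
    also have "\<dots> = (\<Sum>k<A. (\<Sum>a\<in>?S. c (a(j := k)) * (\<Prod>i\<in>I. y i ^ a i)) * y j ^ k)"
      unfolding sum_distrib_right
    proof (intro sum.cong refl)
      fix k a
      have "(\<Prod>i\<in>I. y i ^ (a(j := k)) i) = (\<Prod>i\<in>I. y i ^ a i)"
        using \<open>j \<notin> I\<close> by (intro prod.cong) auto
      then show "c (a(j := k)) * (\<Prod>i\<in>insert j I. y i ^ (a(j := k)) i)
          = c (a(j := k)) * (\<Prod>i\<in>I. y i ^ a i) * y j ^ k"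
        using insert.hyps by simp
    qed
    also have "\<dots> = poly (q y) (y j)" by (simp add: q_def poly_sum poly_monom)
    finally show ?thesis .
  qed
  have q0: "q y = 0" if y: "y \<in> I \<rightarrow> Y" for y
  proof (rule ccontr)
    assume nz: "q y \<noteq> 0"
    have deg: "degree (q y) < A"
    proof -
      have "A > 0" using nz by (cases A) (auto simp: q_def)
      have "degree (q y) \<le> A - 1" unfolding q_def
        by (intro degree_sum_le) (auto intro: order_trans[OF degree_monom_le])
      with \<open>A > 0\<close> show ?thesis by simp
    qed
    have "poly (q y) t = 0" if "t \<in> Y" for t
    proof -
      have "poly (q y) t = poly (q (y(j := t))) ((y(j := t)) j)"
      proof -
        have "(\<Prod>i\<in>I. (y(j := t)) i ^ a i) = (\<Prod>i\<in>I. y i ^ a i)" for a :: "nat \<Rightarrow> nat"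
          using \<open>j \<notin> I\<close> by (intro prod.cong) auto
        then show ?thesis by (simp add: q_def)
      qed
      also have "\<dots> = 0"
        unfolding split[symmetric] by (rule bspec[OF insert.prems(1)]) (use y that in auto)
      finally show ?thesis .
    qed
    then have "card Y \<le> card {t. poly (q y) t = 0}"
      by (intro card_mono poly_roots_finite nz) auto
    also have "\<dots> \<le> degree (q y)" by (rule card_poly_roots_bound[OF nz])
    finally show False using deg assms(3) by simp
  qed
  have a: "a j < A" "a(j := undefined) \<in> ?S"
    using insert.prems(2) insert.hyps by (auto simp: PiE_iff extensional_def)
  define c' where "c' b = c (b(j := a j))" for b
  have "(\<Sum>b\<in>?S. c' b * (\<Prod>i\<in>I. y i ^ b i)) = 0" if "y \<in> I \<rightarrow> Y" for y
  proof -
    have "coeff (q y) (a j) = 0" using that by (simp add: q0)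
    then show ?thesis using a(1) by (simp add: q_def c'_def coeff_sum)
  qed
  then have "c' (a(j := undefined)) = 0"
    using insert.IH[where c = c' and a = "a(j := undefined)"] a(2) by blast
  then show ?case by (simp add: c'_def)
qed

text \<open>
  Gaussian elimination, one equation at a time.
\<close>

lemma underdetermined_system_has_nontrivial_solution:
  fixes m :: "'z \<Rightarrow> 'u \<Rightarrow> real"
  assumes "finite Z" "finite U" "card Z < card U"
  shows "\<exists>c. (\<exists>u\<in>U. c u \<noteq> 0) \<and> (\<forall>z\<in>Z. (\<Sum>u\<in>U. c u * m z u) = 0)"
  using assms
proof (induction Z arbitrary: m U rule: finite_induct)
  case empty
  then obtain u where "u \<in> U" by fastforce
  then show ?case by (intro exI[of _ "\<lambda>_. 1"]) auto
next
  case (insert z Z)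
  show ?case
  proof (cases "\<forall>u\<in>U. m z u = 0")
    case True
    then have row: "(\<Sum>u\<in>U. c u * m z u) = 0" for c by simp
    have "card Z < card U" using insert by simp
    from insert.IH[OF insert.prems(1) this, of m] row show ?thesis by auto
  next
    case False
    then obtain v where v: "v \<in> U" "m z v \<noteq> 0" by blast
    let ?m = "\<lambda>y u. m y u - m z u / m z v * m y v"
    have "card Z < card (U - {v})" using insert v by simp
    from insert.IH[OF _ this, of ?m] insert.prems obtain c where
      c: "\<exists>u\<in>U - {v}. c u \<noteq> 0" "\<forall>y\<in>Z. (\<Sum>u\<in>U - {v}. c u * ?m y u) = 0" by auto
    define w where "w = - (\<Sum>u\<in>U - {v}. c u * m z u) / m z v"
    let ?c = "c(v := w)"
    have expand: "(\<Sum>u\<in>U. ?c u * m y u) = w * m y v + (\<Sum>u\<in>U - {v}. c u * m y u)" for y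
    proof -
      have "(\<Sum>u\<in>U - {v}. ?c u * m y u) = (\<Sum>u\<in>U - {v}. c u * m y u)" by (intro sum.cong) auto
      then show ?thesis using sum.remove[OF insert.prems(1) v(1), of "\<lambda>u. ?c u * m y u"] by simp
    qed
    have "(\<Sum>u\<in>U. ?c u * m y u) = 0" if "y \<in> insert z Z" for y
    proof (cases "y = z")
      case True
      then show ?thesis using v(2) unfolding expand by (simp add: w_def)
    next
      case False
      then have "(\<Sum>u\<in>U - {v}. c u * ?m y u) = 0" using c(2) that by blast
      moreover have "(\<Sum>u\<in>U - {v}. c u * ?m y u)
          = (\<Sum>u\<in>U - {v}. c u * m y u) - (\<Sum>u\<in>U - {v}. c u * m z u) / m z v * m y v"
        unfolding sum_divide_distrib sum_distrib_right sum_subtractf[symmetric]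
        by (intro sum.cong) (simp_all add: algebra_simps)
      ultimately show ?thesis unfolding expand by (simp add: w_def)
    qed
    moreover have "\<exists>u\<in>U. ?c u \<noteq> 0" using c(1) by auto
    ultimately show ?thesis by blast
  qed
qed

section \<open>A weak Bezout theorem\<close>

text \<open>
  The function that numbers the sets is continuous on their compact union because it is locally
  constant there, so by the Stone--Weierstrass theorem some polynomial approximates it up to \<open>1/2\<close>.
  Its degree \<open>b\<close> is not controlled.
\<close>

lemma separate_compact_sets_by_polyfun:
  assumes "finite P"
    and compact: "\<And>c. c \<in> P \<Longrightarrow> compact (K c)"
    and support: "\<And>c x i. c \<in> P \<Longrightarrow> x \<in> K c \<Longrightarrow> i \<notin> I \<Longrightarrow> x i = 0"
    and disjoint: "\<And>c c' x. c \<in> P \<Longrightarrow> c' \<in> P \<Longrightarrow> x \<in> K c \<Longrightarrow> x \<in> K c' \<Longrightarrow> c = c'"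
  shows "\<exists>b g. polyfun I b g \<and>
    (\<forall>c\<in>P. \<forall>c'\<in>P. \<forall>x\<in>K c. \<forall>x'\<in>K c'. g x = g x' \<longrightarrow> c = c')"
proof -
  obtain e :: "'a \<Rightarrow> nat" where e: "inj_on e P"
    using finite_imp_inj_to_nat_seg[OF assms(1)] by blast
  define v where "v x = real (e (THE c. c \<in> P \<and> x \<in> K c))" for x
  have v: "v x = real (e c)" if "c \<in> P" "x \<in> K c" for c x
  proof -
    have "(THE c. c \<in> P \<and> x \<in> K c) = c" using that disjoint by blast
    then show ?thesis by (simp add: v_def)
  qed
  interpret function_ring_on "{f. \<exists>n. polyfun I n f}" "\<Union>(K ` P)"
  proof
    show "compact (\<Union>(K ` P))" using assms(1) compact by (intro compact_UN) auto
  next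
    fix f g assume "f \<in> {f. \<exists>n. polyfun I n f}" "g \<in> {f. \<exists>n. polyfun I n f}"
    then obtain m n where fg: "polyfun I m f" "polyfun I n g" by auto
    then show "(\<lambda>x. f x * g x) \<in> {f. \<exists>n. polyfun I n f}" by (auto intro: polyfun.mult)
    have "polyfun I (max m n) f" "polyfun I (max m n) g"
      using fg by (auto intro: polyfun_mono)
    then show "(\<lambda>x. f x + g x) \<in> {f. \<exists>n. polyfun I n f}" by (auto intro: polyfun.add)
  next
    fix x y assume xy: "x \<in> \<Union>(K ` P)" "y \<in> \<Union>(K ` P)" "x \<noteq> y"
    then obtain i where i: "x i \<noteq> y i" by auto
    from xy(1,2) obtain c c' where "c \<in> P" "x \<in> K c" "c' \<in> P" "y \<in> K c'" by auto
    with i support[of c x i] support[of c' y i] have "i \<in> I" by metis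
    with i show "\<exists>f\<in>{f. \<exists>n. polyfun I n f}. f x \<noteq> f y"
      by (intro bexI[of _ "\<lambda>x. x i"]) (auto intro: polyfun.var)
  qed (auto intro: polyfun.const polyfun_continuous_on)
  have "continuous_on (K c) v" if "c \<in> P" for c
    using that v by (subst continuous_on_cong[OF refl, of _ _ "\<lambda>_. real (e c)"]) auto
  then have "continuous_on (\<Union>(K ` P)) v"
    using assms(1,2) by (intro continuous_on_closed_Union) (auto intro: compact_imp_closed)
  from Stone_Weierstrass_basic[OF this, of "1/2"] obtain b g where
    g: "polyfun I b g" "\<And>x. x \<in> \<Union>(K ` P) \<Longrightarrow> \<bar>v x - g x\<bar> < 1 / 2"
    by auto
  have "c = c'" if "c \<in> P" "c' \<in> P" "x \<in> K c" "x' \<in> K c'" "g x = g x'" for c c' x x'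
  proof -
    have "\<bar>real (e c) - g x\<bar> < 1 / 2" "\<bar>real (e c') - g x'\<bar> < 1 / 2"
      using g(2)[of x] g(2)[of x'] v[of c x] v[of c' x'] that by auto
    then have "e c = e c'" using that(5) by linarith
    then show ?thesis using e that by (auto dest: inj_onD)
  qed
  with g(1) show ?thesis by blast
qed

text \<open>
  A weak Bezout theorem: if every point of a box has a preimage under the polynomial map \<open>\<Phi>\<close> of degree
  \<open>E\<close> in \<open>p\<close> variables in each of finitely many disjoint compact sets, then there are at most
  \<open>(p E + 1)\<^sup>p\<close> of these sets. Otherwise there
  are so many products of powers of the components \<open>\<Phi> i\<close> and of the separating polynomial \<open>g\<close> that
  they are linearly dependent with exponents of \<open>g\<close> below the number \<open>N\<close> of the sets. Fixing a generic
  value \<open>y\<close> of \<open>\<Phi>\<close> in this dependence leaves a nonzero polynomial of degree less than \<open>N\<close>, which has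
  \<open>N\<close> different roots, namely the values of \<open>g\<close> at the preimages of \<open>y\<close>. The bound does not involve the
  degree of \<open>g\<close>, because the exponents of the \<open>\<Phi> i\<close> may be taken large compared to it.
\<close>

lemma card_disjoint_sets_mapped_over_box:
  assumes "finite I" "finite P"
    and \<Phi>: "\<And>i. i \<in> I \<Longrightarrow> polyfun I E (\<Phi> i)"
    and compact: "\<And>c. c \<in> P \<Longrightarrow> compact (K c)"
    and support: "\<And>c x i. c \<in> P \<Longrightarrow> x \<in> K c \<Longrightarrow> i \<notin> I \<Longrightarrow> x i = 0"
    and disjoint: "\<And>c c' x. c \<in> P \<Longrightarrow> c' \<in> P \<Longrightarrow> x \<in> K c \<Longrightarrow> x \<in> K c' \<Longrightarrow> c = c'"
    and "\<delta> > 0"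
    and onto: "\<And>c y. c \<in> P \<Longrightarrow> (\<And>i. i \<in> I \<Longrightarrow> \<bar>y i\<bar> \<le> \<delta>) \<Longrightarrow> \<exists>x\<in>K c. \<forall>i\<in>I. \<Phi> i x = y i"
  shows "card P \<le> (card I * E + 1) ^ card I"
proof (rule ccontr)
  define N p where "N = card P" and "p = card I"
  assume "\<not> card P \<le> (card I * E + 1) ^ card I"
  then have N: "N > (p * E + 1) ^ p" by (simp add: N_def p_def)
  obtain b g where g: "polyfun I b g" and
    sep: "\<And>c c' x x'. c \<in> P \<Longrightarrow> c' \<in> P \<Longrightarrow> x \<in> K c \<Longrightarrow> x' \<in> K c' \<Longrightarrow> g x = g x' \<Longrightarrow> c = c'"
  proof -
    have "\<exists>b g. polyfun I b g \<and>
        (\<forall>c\<in>P. \<forall>c'\<in>P. \<forall>x\<in>K c. \<forall>x'\<in>K c'. g x = g x' \<longrightarrow> c = c')"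
      by (rule separate_compact_sets_by_polyfun) (fact assms(2) compact support disjoint)+
    then show ?thesis using that by metis
  qed
  \<comment> \<open>The products in \<open>U\<close> have degree at most \<open>T\<close>. With this \<open>A\<close> the degree \<open>N b\<close> of the powers of \<open>g\<close> is
    less than \<open>A\<close>, so that \<open>T + 1 \<le> A (p E + 1)\<close>, and the number \<open>A\<^sup>p N\<close> of products exceeds
    the number \<open>(T + 1)\<^sup>p\<close> of grid points.\<close>
  define A T where "A = N * b + 1" and "T = p * (A * E) + N * b"
  define S where "S = PiE I (\<lambda>_. {..<A})"
  define U where "U = S \<times> {..<N}"
  define Z where "Z = PiE I (\<lambda>_. real ` {..T})"
  define m where "m z u = (\<Prod>i\<in>I. \<Phi> i z ^ fst u i) * g z ^ snd u"
    for z and u :: "(nat \<Rightarrow> nat) \<times> nat"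
  have fin: "finite S" "finite U" "finite Z"
    using assms(1) by (auto simp: S_def U_def Z_def intro!: finite_PiE)
  have "card Z = (T + 1) ^ p"
    using assms(1) by (simp add: Z_def p_def card_PiE card_image)
  also have "\<dots> \<le> (A * (p * E + 1)) ^ p"
    by (intro power_mono) (auto simp: T_def A_def algebra_simps)
  also have "\<dots> = A ^ p * (p * E + 1) ^ p" by (rule power_mult_distrib)
  also have "\<dots> < A ^ p * N" using N by (simp add: A_def)
  also have "\<dots> = card U"
    using assms(1) by (simp add: U_def S_def p_def card_PiE card_cartesian_product)
  finally obtain c where c: "\<exists>u\<in>U. c u \<noteq> 0" "\<forall>z\<in>Z. (\<Sum>u\<in>U. c u * m z u) = 0"
    using underdetermined_system_has_nontrivial_solution[OF fin(3,2)] by blast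
  have m: "polyfun I T (\<lambda>z. c u * m z u)" if "u \<in> U" for u
  proof -
    have a: "fst u i < A" if "i \<in> I" for i
      using \<open>u \<in> U\<close> that by (auto simp: U_def S_def)
    have j: "snd u < N" using that by (auto simp: U_def)
    have "polyfun I (A * E) (\<lambda>z. \<Phi> i z ^ fst u i)" if "i \<in> I" for i
      using polyfun_power[OF \<Phi>[OF that], of "fst u i"] a[OF that] by (auto elim!: polyfun_mono)
    then have 1: "polyfun I (p * (A * E)) (\<lambda>z. \<Prod>i\<in>I. \<Phi> i z ^ fst u i)"
      unfolding p_def by (rule polyfun_prod)
    have 2: "polyfun I (N * b) (\<lambda>z. g z ^ snd u)"
      using polyfun_power[OF g, of "snd u"] j by (auto elim!: polyfun_mono)
    have "polyfun I (0 + T) (\<lambda>z. c u * m z u)"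
      unfolding T_def m_def by (rule polyfun.mult[OF polyfun.const polyfun.mult[OF 1 2]])
    then show ?thesis by simp
  qed
  have relation: "(\<Sum>u\<in>U. c u * m x u) = 0" for x
  proof (rule polyfun_vanishes_if_zero_on_grid[OF assms(1) polyfun_sum[OF m]])
    show "finite (real ` {..T})" "T < card (real ` {..T})" by (auto simp: card_image)
  qed (use c(2) in \<open>auto simp: Z_def\<close>)
  \<comment> \<open>The relation, read as a polynomial in \<open>g\<close> whose coefficients are polynomials in \<open>y\<close>.\<close>
  define Q where "Q y j = (\<Sum>a\<in>S. c (a, j) * (\<Prod>i\<in>I. y i ^ a i))" for y j
  obtain a j where aj: "a \<in> S" "j < N" "c (a, j) \<noteq> 0"
    using c(1) by (auto simp: U_def)
  define Y where "Y = (\<lambda>k. \<delta> * real k / real A) ` {..<A}"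
  have "A > 0" by (simp add: A_def)
  then have "card Y = A"
    unfolding Y_def using \<open>\<delta> > 0\<close> by (subst card_image) (auto simp: inj_on_def)
  moreover have "finite Y" by (simp add: Y_def)
  ultimately obtain y where y: "y \<in> I \<rightarrow> Y" "Q y j \<noteq> 0"
    using polynomial_coefficients_unique[OF assms(1), of Y A "\<lambda>a. c (a, j)" a] aj
    unfolding Q_def S_def by auto
  have "\<bar>y i\<bar> \<le> \<delta>" if "i \<in> I" for i
  proof -
    from y(1) that obtain k where "k < A" "y i = \<delta> * (real k / real A)" by (auto simp: Y_def)
    then show ?thesis using \<open>\<delta> > 0\<close> by (simp add: divide_le_eq)
  qed
  then have "\<exists>x\<in>K c. \<forall>i\<in>I. \<Phi> i x = y i" if "c \<in> P" for c using onto that by blast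
  then obtain x where x: "\<And>c. c \<in> P \<Longrightarrow> x c \<in> K c" "\<And>c i. c \<in> P \<Longrightarrow> i \<in> I \<Longrightarrow> \<Phi> i (x c) = y i"
    by metis
  define q where "q = (\<Sum>j<N. monom (Q y j) j)"
  have "coeff q j = Q y j" using aj(2) by (simp add: q_def coeff_sum)
  then have "q \<noteq> 0" using y(2) by auto
  have root: "poly q (g (x k)) = 0" if "k \<in> P" for k
  proof -
    have "poly q (g (x k)) = (\<Sum>j<N. \<Sum>a\<in>S. c (a, j) * m (x k) (a, j))"
      using x(2)[OF that] by (simp add: q_def Q_def m_def poly_sum poly_monom sum_distrib_right mult.assoc)
    also have "\<dots> = (\<Sum>u\<in>U. c u * m (x k) u)"
      unfolding U_def by (subst sum.swap) (simp add: sum.cartesian_product case_prod_beta)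
    finally show ?thesis by (simp add: relation)
  qed
  have "N = card ((\<lambda>c. g (x c)) ` P)"
    unfolding N_def using sep x(1) by (intro card_image[symmetric] inj_onI) blast
  also have "\<dots> \<le> card {t. poly q t = 0}"
    using root by (intro card_mono poly_roots_finite \<open>q \<noteq> 0\<close>) auto
  also have "\<dots> \<le> degree q" by (rule card_poly_roots_bound[OF \<open>q \<noteq> 0\<close>])
  also have "\<dots> \<le> N - 1" unfolding q_def
    by (intro degree_sum_le) (auto intro: order_trans[OF degree_monom_le])
  finally show False using N by simp
qed

section \<open>Sign patterns of polynomials\<close>

text \<open>
  Tychonoff's theorem, for the topology of pointwise convergence on \<open>nat \<Rightarrow> real\<close>.
\<close>

lemma compact_box_in_coordinates:
  assumes "\<And>i. compact (B i)"
  shows "compact {x :: nat \<Rightarrow> real. \<forall>i. x i \<in> B i}"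
proof -
  have "compactin (product_topology (\<lambda>_. euclidean) UNIV) (PiE UNIV B)"
    using assms by (simp add: compactin_PiE)
  then show ?thesis by (simp add: euclidean_product_topology PiE_UNIV_domain Pi_def)
qed

lemma gradient_condition_at_max:
  assumes "finite I" "i \<in> I"
    and deriv: "((\<lambda>t. h (x(i := t))) has_real_derivative d) (at (x i))"
    and max: "\<forall>\<^sub>F t in nhds (x i).
      h (x(i := t)) - (\<Sum>k\<in>I. y k * (x(i := t)) k) \<le> h x - (\<Sum>k\<in>I. y k * x k)"
  shows "d = y i"
proof -
  have lin: "(\<Sum>k\<in>I. y k * (x(i := t)) k) = y i * t + (\<Sum>k\<in>I - {i}. y k * x k)" for t
    by (subst sum.remove[OF assms(1,2)]) (auto intro!: sum.cong)
  let ?u = "\<lambda>t. h (x(i := t)) - (\<Sum>k\<in>I. y k * (x(i := t)) k)"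
  have der: "(?u has_real_derivative d - y i) (at (x i))"
    unfolding lin using deriv by (auto intro!: derivative_eq_intros)
  obtain r where "r > 0" "\<forall>t. dist t (x i) < r \<longrightarrow> ?u t \<le> h x - (\<Sum>k\<in>I. y k * x k)"
    using max unfolding eventually_nhds_metric by blast
  then have "d - y i = 0"
    by (intro DERIV_local_max[OF der]) (auto simp: dist_real_def abs_minus_commute)
  then show ?thesis by simp
qed

text \<open>
  The function \<open>h\<close> minus the linear form with coefficients \<open>y\<close> attains its maximum over the compact
  cell \<open>C\<close>. On the boundary \<open>h\<close> vanishes, while \<open>h w \<ge> \<mu>\<close> and the linear form is small, so the maximum
  is in the interior and the gradient of \<open>h\<close> equals \<open>y\<close> there.
\<close>

lemma critical_points_in_cell:
  assumes "finite I" "finite J"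
    and F: "\<And>j. j \<in> J \<Longrightarrow> polyfun I D (F j)"
    and C: "C = {x. (\<forall>i. i \<notin> I \<longrightarrow> x i = 0) \<and> (\<forall>j\<in>J. F j x \<ge> 0)}"
    and "compact C"
    and bound: "\<And>x i. x \<in> C \<Longrightarrow> i \<in> I \<Longrightarrow> \<bar>x i\<bar> \<le> R"
    and h: "polyfun I E h"
    and h': "\<And>i x. i \<in> I \<Longrightarrow> ((\<lambda>t. h (x(i := t))) has_real_derivative h' i x) (at (x i))"
    and zero: "\<And>j x. j \<in> J \<Longrightarrow> F j x = 0 \<Longrightarrow> h x = 0"
    and w: "w \<in> C" "h w \<ge> \<mu>" "\<mu> > 0"
    and y: "\<And>i. i \<in> I \<Longrightarrow> \<bar>y i\<bar> * R \<le> \<mu> / (4 * (card I + 1))"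
  shows "\<exists>x\<in>C. h x \<ge> \<mu> / 2 \<and> (\<forall>i\<in>I. h' i x = y i)"
proof -
  define u where "u x = h x - (\<Sum>k\<in>I. y k * x k)" for x
  have "polyfun I (Suc E) (\<lambda>x. y k * x k)" if "k \<in> I" for k
    by (rule polyfun_cmult[OF polyfun.var[OF that]])
  then have lin: "polyfun I (Suc E) (\<lambda>x. \<Sum>k\<in>I. y k * x k)" by (rule polyfun_sum)
  have "polyfun I (Suc E) h" using polyfun_mono[OF h] by simp
  from polyfun_diff[OF this lin] have "polyfun I (Suc E) u" by (simp add: u_def[abs_def])
  then have "continuous_on C u" by (rule polyfun_continuous_on)
  then obtain x where x: "x \<in> C" "\<And>z. z \<in> C \<Longrightarrow> u z \<le> u x"
    using continuous_attains_sup[OF \<open>compact C\<close>] w(1) by blast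
  have lin: "\<bar>\<Sum>k\<in>I. y k * z k\<bar> \<le> \<mu> / 4" if "z \<in> C" for z
  proof -
    have "\<bar>\<Sum>k\<in>I. y k * z k\<bar> \<le> (\<Sum>k\<in>I. \<mu> / (4 * (card I + 1)))"
    proof (rule order_trans[OF sum_abs], rule sum_mono)
      fix k assume "k \<in> I"
      then have "\<bar>y k * z k\<bar> \<le> \<bar>y k\<bar> * R"
        using bound[OF that] by (auto simp: abs_mult intro: mult_left_mono)
      with y[OF \<open>k \<in> I\<close>] show "\<bar>y k * z k\<bar> \<le> \<mu> / (4 * (card I + 1))" by linarith
    qed
    also have "\<dots> \<le> \<mu> / 4" using w(3) by (simp add: field_simps)
    finally show ?thesis .
  qed
  have hx: "h x \<ge> \<mu> / 2"
    using x(2)[OF w(1)] lin[OF x(1)] lin[OF w(1)] w(2) unfolding u_def by linarith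
  have inner: "F j x > 0" if "j \<in> J" for j
    using zero[OF that, of x] hx w(3) x(1) that by (force simp: C)
  have "h' i x = y i" if i: "i \<in> I" for i
  proof (rule gradient_condition_at_max[where h = h and x = x and y = y, OF assms(1) i h'[OF i]])
    have cont: "isCont (\<lambda>t. F j (x(i := t))) (x i)" if "j \<in> J" for j
      using polyfun_partial_derivative[OF F[OF that], of i] by (auto intro: DERIV_isCont)
    have "\<forall>\<^sub>F t in at (x i). F j (x(i := t)) > 0" if "j \<in> J" for j
      using cont[OF that] inner[OF that] by (auto simp: isCont_def intro: order_tendstoD)
    then have "\<forall>\<^sub>F t in nhds (x i). F j (x(i := t)) > 0" if "j \<in> J" for j
      using inner that by (simp add: eventually_nhds_conv_at)
    then have "\<forall>\<^sub>F t in nhds (x i). \<forall>j\<in>J. F j (x(i := t)) > 0"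
      using assms(2) by (simp add: eventually_ball_finite)
    then show "\<forall>\<^sub>F t in nhds (x i).
        h (x(i := t)) - (\<Sum>k\<in>I. y k * (x(i := t)) k) \<le> h x - (\<Sum>k\<in>I. y k * x k)"
    proof eventually_elim
      case (elim t)
      then have "x(i := t) \<in> C" using x(1) i by (auto simp: C less_imp_le)
      from x(2)[OF this] show ?case by (simp only: u_def)
    qed
  qed
  with x(1) hx show ?thesis by blast
qed

text \<open>
  Each pattern has a witness. Subtracting a small \<open>\<epsilon>\<close> from all \<open>f j\<close> makes the inequalities at the
  witnesses strict without changing the patterns there, and multiplying by the equation of a large
  ball makes the cells bounded. The gradient of the square \<open>h\<close> of the whole product then maps each
  cell over a common box around the origin.
\<close>

lemma card_sign_patterns_of_polyfuns:
  assumes "finite I" "finite J"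
    and f: "\<And>j. j \<in> J \<Longrightarrow> polyfun I D (f j)"
  shows "card (range (\<lambda>x. {j \<in> J. f j x > 0})) \<le> (card I * (2 * (card J * D) + 4) + 1) ^ card I"
proof -
  define P where "P = range (\<lambda>x. {j \<in> J. f j x > 0})"
  have fin: "finite P"
    by (rule finite_subset[of _ "Pow J"]) (auto simp: P_def assms(2))
  have "P \<noteq> {}" by (simp add: P_def)
  have "\<exists>x. {j \<in> J. f j x > 0} = c \<and> (\<forall>i. i \<notin> I \<longrightarrow> x i = 0)" if c: "c \<in> P" for c
  proof -
    obtain x where "c = {j \<in> J. f j x > 0}" using c by (auto simp: P_def)
    moreover have "f j x = f j (\<lambda>i. if i \<in> I then x i else 0)" if "j \<in> J" for j
      by (rule polyfun_cong[OF f[OF that]]) simp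
    ultimately show ?thesis by (intro exI[of _ "\<lambda>i. if i \<in> I then x i else 0"]) auto
  qed
  then obtain w where w: "\<And>c. c \<in> P \<Longrightarrow> {j \<in> J. f j (w c) > 0} = c"
    "\<And>c i. c \<in> P \<Longrightarrow> i \<notin> I \<Longrightarrow> w c i = 0" by metis
  \<comment> \<open>The \<open>1\<close> only makes the set nonempty.\<close>
  define V where "V = insert 1 ((\<lambda>(c, j). f j (w c)) ` (SIGMA c : P. c))"
  define \<epsilon> where "\<epsilon> = Min V / 2"
  have sub: "c \<subseteq> J" if "c \<in> P" for c using that by (auto simp: P_def)
  have V: "finite V" unfolding V_def
    using fin sub assms(2) by (auto intro!: finite_SigmaI intro: finite_subset)
  have "\<forall>v\<in>V. v > 0" using w(1) by (auto simp: V_def)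
  then have "Min V > 0" using V by (subst Min_gr_iff) (auto simp: V_def)
  moreover have "f j (w c) \<ge> Min V" if "c \<in> P" "j \<in> c" for c j
    using that V by (intro Min_le) (auto simp: V_def)
  ultimately have \<epsilon>: "\<epsilon> > 0" "\<And>c j. c \<in> P \<Longrightarrow> j \<in> c \<Longrightarrow> f j (w c) > \<epsilon>"
    by (force simp: \<epsilon>_def)+
  define g where "g j x = f j x - \<epsilon>" for j x
  define s where "s c j = (if j \<in> c then 1 else - 1 :: real)" for c and j :: 'a
  have sg: "s c j * g j (w c) > 0" if "c \<in> P" "j \<in> J" for c j
  proof (cases "j \<in> c")
    case True
    then show ?thesis using \<epsilon>(2)[OF that(1)] by (simp add: s_def g_def)
  next
    case False
    then have "f j (w c) \<le> 0" using w(1)[OF that(1)] that(2) by force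
    then show ?thesis using \<epsilon>(1) False by (simp add: s_def g_def)
  qed
  define R where "R = 1 + Max ((\<lambda>c. \<Sum>i\<in>I. (w c i)\<^sup>2) ` P)"
  have R: "(\<Sum>i\<in>I. (w c i)\<^sup>2) < R" if "c \<in> P" for c
  proof -
    have "(\<Sum>i\<in>I. (w c i)\<^sup>2) \<le> Max ((\<lambda>c. \<Sum>i\<in>I. (w c i)\<^sup>2) ` P)"
      using fin that by (intro Max_ge) auto
    then show ?thesis by (simp add: R_def)
  qed
  have "R \<ge> 1"
  proof -
    obtain c where "c \<in> P" using \<open>P \<noteq> {}\<close> by blast
    then have "(\<Sum>i\<in>I. (w c i)\<^sup>2) \<le> Max ((\<lambda>c. \<Sum>i\<in>I. (w c i)\<^sup>2) ` P)"
      using fin by (intro Max_ge) auto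
    moreover have "0 \<le> (\<Sum>i\<in>I. (w c i)\<^sup>2)" by (simp add: sum_nonneg)
    ultimately show ?thesis by (simp add: R_def)
  qed
  define b where "b x = R - (\<Sum>i\<in>I. (x i)\<^sup>2)" for x :: "nat \<Rightarrow> real"
  have pb: "polyfun I 2 b"
  proof -
    have "polyfun I (2 * 1) (\<lambda>x. (x i)\<^sup>2)" if "i \<in> I" for i
      using polyfun_power[OF polyfun.var[OF that, of 0], of 2] by simp
    then have "polyfun I 2 (\<lambda>x. \<Sum>i\<in>I. (x i)\<^sup>2)" by (intro polyfun_sum) simp
    then show ?thesis unfolding b_def[abs_def] by (rule polyfun_diff[OF polyfun.const])
  qed
  define h where "h x = (b x * (\<Prod>j\<in>J. g j x))\<^sup>2" for x
  have pg: "polyfun I D (g j)" if "j \<in> J" for j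
    unfolding g_def[abs_def] by (rule polyfun_diff[OF f[OF that] polyfun.const])
  have ph: "polyfun I (2 * (card J * D) + 4) h"
  proof -
    have "polyfun I (2 * (2 + card J * D)) h" unfolding h_def[abs_def]
      by (rule polyfun_power[OF polyfun.mult[OF pb polyfun_prod[of J I D g, OF pg]]])
    then show ?thesis by (rule polyfun_mono) simp
  qed
  obtain h' where h': "\<And>i. polyfun I (2 * (card J * D) + 4) (h' i)"
    "\<And>i x. ((\<lambda>t. h (x(i := t))) has_real_derivative h' i x) (at (x i))"
    using polyfun_partial_derivative[OF ph] by metis
  \<comment> \<open>The level \<open>\<mu> / 2\<close> keeps the compact sets \<open>K c\<close> away from the boundaries of the cells.\<close>
  define \<mu> where "\<mu> = Min ((\<lambda>c. h (w c)) ` P)"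
  have \<mu>: "\<mu> > 0" "\<And>c. c \<in> P \<Longrightarrow> h (w c) \<ge> \<mu>"
  proof -
    have "h (w c) > 0" if "c \<in> P" for c
    proof -
      have "g j (w c) \<noteq> 0" if "j \<in> J" for j using sg[OF \<open>c \<in> P\<close> that] by auto
      then show ?thesis using R[OF that] assms(2) by (simp add: h_def b_def)
    qed
    then show "\<mu> > 0" unfolding \<mu>_def using fin \<open>P \<noteq> {}\<close> by (subst Min_gr_iff) auto
    show "h (w c) \<ge> \<mu>" if "c \<in> P" for c
      unfolding \<mu>_def using fin that by (intro Min_le) auto
  qed
  \<comment> \<open>\<open>None\<close> stands for the ball, \<open>Some j\<close> for the polynomial \<open>g j\<close> with the sign it has in the cell.\<close>
  define F where "F c k x = (case k of None \<Rightarrow> b x | Some j \<Rightarrow> s c j * g j x)" for c k x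
  define J' where "J' = insert None (Some ` J)"
  define C where "C c = {x. (\<forall>i. i \<notin> I \<longrightarrow> x i = 0) \<and> (\<forall>k\<in>J'. F c k x \<ge> 0)}" for c
  have pF: "polyfun I (D + 2) (F c k)" if "k \<in> J'" for c k
  proof (cases k)
    case None
    then show ?thesis using polyfun_mono[OF pb] by (simp add: F_def[abs_def])
  next
    case (Some j)
    then have "j \<in> J" using that by (auto simp: J'_def)
    from polyfun_mono[OF polyfun_cmult[OF pg[OF this]]] Some show ?thesis
      by (simp add: F_def[abs_def])
  qed
  have bounded: "\<bar>x i\<bar> \<le> R" if "x \<in> C c" for x c i
  proof (cases "i \<in> I")
    case True
    have "b x \<ge> 0" using that by (force simp: C_def F_def J'_def)
    then have "(x i)\<^sup>2 \<le> R"
      using member_le_sum[OF True, of "\<lambda>i. (x i)\<^sup>2"] assms(1) by (simp add: b_def)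
    also have "\<dots> \<le> R\<^sup>2" using \<open>R \<ge> 1\<close> by (simp add: power2_eq_square)
    finally show ?thesis using \<open>R \<ge> 1\<close> by (simp add: abs_le_square_iff[symmetric])
  next
    case False
    then show ?thesis using that \<open>R \<ge> 1\<close> by (simp add: C_def)
  qed
  have compact: "compact (C c)" for c
  proof -
    let ?B = "\<lambda>i. if i \<in> I then {-R..R} else {0}"
    have "closed {x. F c k x \<ge> 0}" if "k \<in> J'" for k
      using polyfun_continuous_on[OF pF[OF that]] by (intro closed_Collect_le) auto
    then have "closed (\<Inter>k\<in>J'. {x. F c k x \<ge> 0})" by (intro closed_INT) auto
    moreover have "compact {x. \<forall>i. x i \<in> ?B i}" by (rule compact_box_in_coordinates) auto
    ultimately have "compact ({x. \<forall>i. x i \<in> ?B i} \<inter> (\<Inter>k\<in>J'. {x. F c k x \<ge> 0}))"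
      by (rule compact_Int_closed[rotated])
    also have "{x. \<forall>i. x i \<in> ?B i} \<inter> (\<Inter>k\<in>J'. {x. F c k x \<ge> 0}) = C c" (is "?l = _")
    proof
      show "?l \<subseteq> C c" by (auto simp: C_def split: if_splits)
      show "C c \<subseteq> ?l" using bounded[of _ c] by (auto simp: C_def abs_le_iff minus_le_iff)
    qed
    finally show ?thesis .
  qed
  define K where "K c = {x \<in> C c. h x \<ge> \<mu> / 2}" for c
  define \<delta> where "\<delta> = \<mu> / (4 * (card I + 1)) / R"
  show ?thesis unfolding P_def[symmetric]
  proof (rule card_disjoint_sets_mapped_over_box[OF assms(1) fin h'(1)])
    show "compact (K c)" for c
    proof -
      have "closed {x. h x \<ge> \<mu> / 2}"
        using polyfun_continuous_on[OF ph] by (intro closed_Collect_le) auto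
      then have "compact (C c \<inter> {x. h x \<ge> \<mu> / 2})" by (rule compact_Int_closed[OF compact])
      then show ?thesis by (simp add: K_def Int_def)
    qed
    show "x i = 0" if "x \<in> K c" "i \<notin> I" for c x i using that by (simp add: K_def C_def)
    show "c = c'" if "c \<in> P" "c' \<in> P" "x \<in> K c" "x \<in> K c'" for c c' x
    proof -
      have "h x \<noteq> 0" using that(3) \<mu>(1) by (auto simp: K_def)
      then have nz: "g j x \<noteq> 0" if "j \<in> J" for j
        using that assms(2) by (auto simp: h_def)
      have "j \<in> c \<longleftrightarrow> j \<in> c'" if "j \<in> J" for j
      proof -
        have "s c j * g j x \<ge> 0" "s c' j * g j x \<ge> 0"
          using \<open>x \<in> K c\<close> \<open>x \<in> K c'\<close> that by (force simp: K_def C_def F_def J'_def)+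
        with nz[OF that] show ?thesis by (auto simp: s_def split: if_splits)
      qed
      with sub that(1,2) show ?thesis by blast
    qed
    show "\<delta> > 0" using \<mu>(1) \<open>R \<ge> 1\<close> by (simp add: \<delta>_def)
    show "\<exists>x\<in>K c. \<forall>i\<in>I. h' i x = y i" if "c \<in> P" "\<And>i. i \<in> I \<Longrightarrow> \<bar>y i\<bar> \<le> \<delta>" for c y
    proof -
      have "\<exists>x\<in>C c. h x \<ge> \<mu> / 2 \<and> (\<forall>i\<in>I. h' i x = y i)"
      proof (rule critical_points_in_cell[where F = "F c" and J = J' and I = I and R = R
            and w = "w c" and D = "D + 2"])
        show "C c = {x. (\<forall>i. i \<notin> I \<longrightarrow> x i = 0) \<and> (\<forall>k\<in>J'. F c k x \<ge> 0)}" by (fact C_def)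
        show "\<bar>x i\<bar> \<le> R" if "x \<in> C c" for x i using that by (rule bounded)
        show "polyfun I (D + 2) (F c k)" if "k \<in> J'" for k using that by (rule pF)
        show "((\<lambda>t. h (x(i := t))) has_real_derivative h' i x) (at (x i))" for i x by (rule h'(2))
        show "polyfun I (2 * (card J * D) + 4) h" by (rule ph)
        show "h x = 0" if "k \<in> J'" "F c k x = 0" for k x
          using that assms(2) by (auto simp: F_def h_def J'_def s_def split: if_splits)
        show "w c \<in> C c"
          using w(2)[OF \<open>c \<in> P\<close>] R[OF \<open>c \<in> P\<close>] sg[OF \<open>c \<in> P\<close>]
          by (auto simp: C_def F_def b_def J'_def less_imp_le)
        show "\<bar>y i\<bar> * R \<le> \<mu> / (4 * (card I + 1))" if "i \<in> I" for i
          using \<open>i \<in> I \<Longrightarrow> \<bar>y i\<bar> \<le> \<delta>\<close> that \<open>R \<ge> 1\<close> by (simp add: \<delta>_def pos_le_divide_eq mult_ac)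
      qed (use assms(1,2) \<mu> that compact in \<open>auto simp: J'_def\<close>)
      then show ?thesis by (auto simp: K_def)
    qed
  qed
qed

section \<open>Degrees and gates of expressions\<close>

text \<open>
  A formal degree in the parameters. It is an integer, since the \<open>j\<close>-th derivative of \<open>ReLU\<^sup>k\<close> gets the
  factor \<open>k - j\<close> also for \<open>j > k\<close>, where it is the zero function. With this convention the chain rule
  and the product rule never increase the degree, and an expression of negative degree denotes the
  zero function.
\<close>

primrec deg :: "expr \<Rightarrow> int" where
  "deg (Coord i) = 0"
| "deg (Param p) = 1"
| "deg (Const c) = 0"
| "deg (Add a b) = max (deg a) (deg b)"
| "deg (Sub a b) = max (deg a) (deg b)"
| "deg (Mul a b) = deg a + deg b"
| "deg (Act k j a) = (int k - int j) * deg a"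

primrec params :: "expr \<Rightarrow> nat set" where
  "params (Coord i) = {}"
| "params (Param p) = {p}"
| "params (Const c) = {}"
| "params (Add a b) = params a \<union> params b"
| "params (Sub a b) = params a \<union> params b"
| "params (Mul a b) = params a \<union> params b"
| "params (Act k j a) = params a"

text \<open>
  The pre-activations whose signs select the polynomial piece.
\<close>

primrec gates :: "expr \<Rightarrow> expr set" where
  "gates (Coord i) = {}"
| "gates (Param p) = {}"
| "gates (Const c) = {}"
| "gates (Add a b) = gates a \<union> gates b"
| "gates (Sub a b) = gates a \<union> gates b"
| "gates (Mul a b) = gates a \<union> gates b"
| "gates (Act k j a) = insert a (gates a)"

text \<open>
  The polynomial piece that is active at \<open>\<theta>\<^sub>0\<close>, as a function of \<open>\<theta>\<close>. The branch of
  each activation function is chosen by the sign of its argument at \<open>\<theta>\<^sub>0\<close>, while the argument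
  itself is evaluated at \<open>\<theta>\<close>.
\<close>

primrec frozen :: "(nat \<Rightarrow> real) \<Rightarrow> (nat \<Rightarrow> real) \<Rightarrow> expr \<Rightarrow> (nat \<Rightarrow> real) \<Rightarrow> real" where
  "frozen \<theta>\<^sub>0 x (Coord i) = (\<lambda>\<theta>. x i)"
| "frozen \<theta>\<^sub>0 x (Param p) = (\<lambda>\<theta>. \<theta> p)"
| "frozen \<theta>\<^sub>0 x (Const c) = (\<lambda>\<theta>. c)"
| "frozen \<theta>\<^sub>0 x (Add a b) = (\<lambda>\<theta>. frozen \<theta>\<^sub>0 x a \<theta> + frozen \<theta>\<^sub>0 x b \<theta>)"
| "frozen \<theta>\<^sub>0 x (Sub a b) = (\<lambda>\<theta>. frozen \<theta>\<^sub>0 x a \<theta> - frozen \<theta>\<^sub>0 x b \<theta>)"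
| "frozen \<theta>\<^sub>0 x (Mul a b) = (\<lambda>\<theta>. frozen \<theta>\<^sub>0 x a \<theta> * frozen \<theta>\<^sub>0 x b \<theta>)"
| "frozen \<theta>\<^sub>0 x (Act k j a) =
     (\<lambda>\<theta>. if eval \<theta>\<^sub>0 x a > 0 then (\<Prod>i<j. real k - real i) * frozen \<theta>\<^sub>0 x a \<theta> ^ (k - j) else 0)"

lemma frozen_eq_eval:
  assumes "pos_exps e" "\<And>a. a \<in> gates e \<Longrightarrow> eval \<theta> x a > 0 \<longleftrightarrow> eval \<theta>\<^sub>0 x a > 0"
  shows "frozen \<theta>\<^sub>0 x e \<theta> = eval \<theta> x e"
  using assms
proof (induction e)
  case (Act k j a)
  have active: "eval \<theta> x a > 0 \<longleftrightarrow> eval \<theta>\<^sub>0 x a > 0" using Act.prems(2)[of a] by simp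
  have "frozen \<theta>\<^sub>0 x a \<theta> = eval \<theta> x a" "k \<ge> 1" using Act by auto
  then show ?case
    by (cases "eval \<theta> x a > 0"; cases "j = 0")
      (simp_all add: active[symmetric] relu_pow_deriv_def step_def relu_def)
qed auto

text \<open>
  The delicate case is an active gate with an argument of negative degree: it does not exist, since
  such an argument is zero and a gate with argument zero is inactive.
\<close>

lemma polyfun_frozen:
  assumes "pos_exps e" "params e \<subseteq> I"
  shows "(deg e \<ge> 0 \<longrightarrow> polyfun I (nat (deg e)) (frozen \<theta>\<^sub>0 x e)) \<and>
    (deg e < 0 \<longrightarrow> frozen \<theta>\<^sub>0 x e = (\<lambda>_. 0))"
  using assms
proof (induction e)
  case (Coord i)
  then show ?case by (simp add: polyfun.const)
next
  case (Param p)
  then show ?case using polyfun.var[of p I 0] by simp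
next
  case (Const c)
  then show ?case by (simp add: polyfun.const)
next
  case (Add a b)
  have *: "polyfun I (nat (deg (Add a b))) (frozen \<theta>\<^sub>0 x c)" if "c \<in> {a, b}" for c
    using Add that by (cases "deg c \<ge> 0") (auto intro: polyfun.const elim!: polyfun_mono)
  have "polyfun I (nat (deg (Add a b))) (frozen \<theta>\<^sub>0 x (Add a b))"
    unfolding frozen.simps by (rule polyfun.add) (use * in auto)
  then show ?case using Add by auto
next
  case (Sub a b)
  have *: "polyfun I (nat (deg (Sub a b))) (frozen \<theta>\<^sub>0 x c)" if "c \<in> {a, b}" for c
    using Sub that by (cases "deg c \<ge> 0") (auto intro: polyfun.const elim!: polyfun_mono)
  have "polyfun I (nat (deg (Sub a b))) (frozen \<theta>\<^sub>0 x (Sub a b))"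
    unfolding frozen.simps by (rule polyfun_diff) (use * in auto)
  then show ?case using Sub by auto
next
  case (Mul a b)
  show ?case
  proof (cases "deg a \<ge> 0 \<and> deg b \<ge> 0")
    case True
    have "polyfun I (nat (deg a) + nat (deg b)) (frozen \<theta>\<^sub>0 x (Mul a b))"
      unfolding frozen.simps by (rule polyfun.mult) (use Mul True in auto)
    then show ?thesis using True by (simp add: nat_add_distrib)
  next
    case False
    then have "frozen \<theta>\<^sub>0 x a = (\<lambda>_. 0) \<or> frozen \<theta>\<^sub>0 x b = (\<lambda>_. 0)" using Mul by auto
    then have "frozen \<theta>\<^sub>0 x (Mul a b) = (\<lambda>_. 0)" by auto
    then show ?thesis using polyfun.const by metis
  qed
next
  case (Act k j a)
  show ?case
  proof (cases "eval \<theta>\<^sub>0 x a > 0 \<and> j \<le> k")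
    case True
    have "deg a \<ge> 0"
    proof (rule ccontr)
      assume "\<not> deg a \<ge> 0"
      then have "frozen \<theta>\<^sub>0 x a \<theta>\<^sub>0 = 0" using Act by auto
      then show False using frozen_eq_eval[of a \<theta>\<^sub>0 x \<theta>\<^sub>0] Act.prems True by simp
    qed
    moreover have "nat ((int k - int j) * deg a) = (k - j) * nat (deg a)"
    proof -
      have "int k - int j = int (k - j)" using True by simp
      then show ?thesis by (simp only: nat_mult_distrib of_nat_0_le_iff nat_int)
    qed
    moreover have "polyfun I ((k - j) * nat (deg a)) (frozen \<theta>\<^sub>0 x (Act k j a))"
      using True polyfun_cmult[OF polyfun_power] Act \<open>deg a \<ge> 0\<close> by simp
    moreover have "deg (Act k j a) \<ge> 0" using True \<open>deg a \<ge> 0\<close> by simp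
    ultimately show ?thesis by (simp only: deg.simps not_less[symmetric]) simp
  next
    case False
    have "frozen \<theta>\<^sub>0 x (Act k j a) = (\<lambda>_. 0)"
    proof (cases "j \<le> k")
      case False
      then have "(\<Prod>i<j. real k - real i) = 0" by (subst prod_zero_iff) auto
      then show ?thesis by auto
    qed (use False in auto)
    then show ?thesis using polyfun.const by metis
  qed
qed

lemma polyfun_frozen_bound:
  assumes "pos_exps e" "params e \<subseteq> I" "deg e \<le> int D"
  shows "polyfun I D (frozen \<theta>\<^sub>0 x e)"
  using polyfun_frozen[OF assms(1,2), of \<theta>\<^sub>0 x] assms(3)
  by (cases "deg e \<ge> 0") (auto intro: polyfun.const elim!: polyfun_mono)

lemma pos_exps_pd: "pos_exps e \<Longrightarrow> pos_exps (pd i e)"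
  by (induction e) auto

lemma params_pd: "params (pd i e) \<subseteq> params e"
  by (induction e) auto

lemma gates_pd: "gates (pd i e) \<subseteq> gates e"
  by (induction e) auto

lemma deg_pd: "deg (pd i e) \<le> deg e"
proof (induction e)
  case (Act k j a)
  then show ?case by (simp add: algebra_simps)
qed auto

lemma deriv_mi_induct:
  assumes "Q e" "\<And>i e. Q e \<Longrightarrow> Q (pd i e)"
  shows "Q (deriv_mi d \<alpha> e)"
proof -
  have power: "Q ((pd i ^^ n) e)" if "Q e" for i n e using that by (induction n) (auto intro: assms(2))
  have "Q (foldr (\<lambda>i. pd i ^^ \<alpha> i) is e)" for "is" by (induction "is") (auto intro: assms(1) power)
  then show ?thesis by (simp add: deriv_mi_def)
qed

lemma deriv_mi_properties:
  assumes "pos_exps e"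
  shows "pos_exps (deriv_mi d \<alpha> e)" "params (deriv_mi d \<alpha> e) \<subseteq> params e"
    "gates (deriv_mi d \<alpha> e) \<subseteq> gates e" "deg (deriv_mi d \<alpha> e) \<le> deg e"
proof -
  have "pos_exps (deriv_mi d \<alpha> e) \<and> params (deriv_mi d \<alpha> e) \<subseteq> params e \<and>
      gates (deriv_mi d \<alpha> e) \<subseteq> gates e \<and> deg (deriv_mi d \<alpha> e) \<le> deg e"
    by (rule deriv_mi_induct)
      (use assms pos_exps_pd in \<open>auto dest!: params_pd[THEN subsetD] gates_pd[THEN subsetD]
        intro: order_trans[OF deg_pd]\<close>)
  then show "pos_exps (deriv_mi d \<alpha> e)" "params (deriv_mi d \<alpha> e) \<subseteq> params e"
    "gates (deriv_mi d \<alpha> e) \<subseteq> gates e" "deg (deriv_mi d \<alpha> e) \<le> deg e" by auto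
qed

section \<open>Sign patterns of layered expressions\<close>

lemma card_range_pair_le:
  assumes fin: "finite (range g)"
    and fibre: "\<And>a. finite (h ` {b. g b = g a}) \<and> card (h ` {b. g b = g a}) \<le> B"
  shows "card (range (\<lambda>a. (g a, h a))) \<le> card (range g) * B"
proof -
  have "range (\<lambda>a. (g a, h a)) = (\<Union>v\<in>range g. Pair v ` h ` {b. g b = v})"
    by (auto simp: image_iff) metis+
  also have "card \<dots> \<le> (\<Sum>v\<in>range g. card (Pair v ` h ` {b. g b = v}))"
    by (rule card_UN_le[OF fin])
  also have "\<dots> \<le> (\<Sum>v\<in>range g. B)"
  proof (rule sum_mono)
    fix v assume "v \<in> range g"
    then obtain a where "v = g a" by auto
    with fibre[of a] show "card (Pair v ` h ` {b. g b = v}) \<le> B"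
      using card_image_le order_trans by blast
  qed
  finally show ?thesis by simp
qed

text \<open>
  The expressions in \<open>G l\<close> depend on signs in the earlier layers only. On a set of parameters with a
  common sign pattern in the layers before \<open>n\<close>, the values of the expressions in \<open>G n\<close> at the points of \<open>X\<close>
  are therefore at most \<open>card X * W\<close> polynomials in the parameters, which have a bounded number of
  sign patterns; this number is the factor that the layer \<open>n\<close> contributes.
\<close>

lemma card_layered_gate_patterns:
  fixes G :: "nat \<Rightarrow> expr set"
  assumes "finite I" "finite X"
    and fin: "\<And>l. l < n \<Longrightarrow> finite (G l)"
    and width: "\<And>l. l < n \<Longrightarrow> card (G l) \<le> W"
    and G: "\<And>l e. l < n \<Longrightarrow> e \<in> G l \<Longrightarrow> pos_exps e \<and> params e \<subseteq> I \<and> deg e \<le> int D"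
    and layered: "\<And>l e. l < n \<Longrightarrow> e \<in> G l \<Longrightarrow> gates e \<subseteq> (\<Union>l'<l. G l')"
  shows "card (range (\<lambda>\<theta>. {(x, e) \<in> X \<times> (\<Union>l<n. G l). eval \<theta> x e > 0}))
    \<le> ((card I * (2 * (card X * W * D) + 4) + 1) ^ card I) ^ n"
  using fin width G layered
proof (induction n)
  case 0
  then show ?case by (simp add: image_constant_conv)
next
  case (Suc n)
  let ?B = "(card I * (2 * (card X * W * D) + 4) + 1) ^ card I"
  \<comment> \<open>The pattern splits into the old part \<open>g\<close> and the contribution \<open>h\<close> of the new layer.\<close>
  define g where "g \<theta> = {(x, e) \<in> X \<times> (\<Union>l<n. G l). eval \<theta> x e > 0}" for \<theta>
  define h where "h \<theta> = {(x, e) \<in> X \<times> G n. eval \<theta> x e > 0}" for \<theta>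
  have fin_g: "finite (range g)"
    by (rule finite_subset[of _ "Pow (X \<times> (\<Union>l<n. G l))"])
      (use assms(2) Suc.prems(1) in \<open>auto simp: g_def\<close>)
  have IH: "card (range g) \<le> ?B ^ n"
    unfolding g_def
  proof (rule Suc.IH)
    fix l assume "l < n"
    then have l: "l < Suc n" by simp
    show "finite (G l)" "card (G l) \<le> W" by (fact Suc.prems(1,2)[OF l])+
    fix e assume "e \<in> G l"
    with l show "pos_exps e \<and> params e \<subseteq> I \<and> deg e \<le> int D" "gates e \<subseteq> (\<Union>l'<l. G l')"
      by (fact Suc.prems(3,4))+
  qed
  have fibre: "finite (h ` {\<theta>. g \<theta> = g \<theta>\<^sub>0}) \<and> card (h ` {\<theta>. g \<theta> = g \<theta>\<^sub>0}) \<le> ?B" for \<theta>\<^sub>0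
  proof -
    let ?J = "X \<times> G n"
    let ?s = "\<lambda>\<theta>. {j \<in> ?J. (case j of (x, e) \<Rightarrow> frozen \<theta>\<^sub>0 x e) \<theta> > 0}"
    have J: "finite ?J" using assms(2) Suc.prems(1) by simp
    have eq: "h \<theta> = ?s \<theta>" if "g \<theta> = g \<theta>\<^sub>0" for \<theta>
    proof -
      have gate: "eval \<theta> x a > 0 \<longleftrightarrow> eval \<theta>\<^sub>0 x a > 0" if "x \<in> X" "a \<in> (\<Union>l<n. G l)" for x a
      proof -
        have "eval \<theta> x a > 0 \<longleftrightarrow> (x, a) \<in> g \<theta>" "eval \<theta>\<^sub>0 x a > 0 \<longleftrightarrow> (x, a) \<in> g \<theta>\<^sub>0"
          using that by (auto simp: g_def)
        with \<open>g \<theta> = g \<theta>\<^sub>0\<close> show ?thesis by simp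
      qed
      have "frozen \<theta>\<^sub>0 x e \<theta> = eval \<theta> x e" if "x \<in> X" "e \<in> G n" for x e
      proof (rule frozen_eq_eval)
        show "pos_exps e" using that Suc.prems(3)[of n e] by simp
        show "eval \<theta> x a > 0 \<longleftrightarrow> eval \<theta>\<^sub>0 x a > 0" if "a \<in> gates e" for a
          using Suc.prems(4)[of n e] \<open>e \<in> G n\<close> that by (intro gate[OF \<open>x \<in> X\<close>]) auto
      qed
      then show ?thesis by (auto simp: h_def)
    qed
    have poly: "polyfun I D (case j of (x, e) \<Rightarrow> frozen \<theta>\<^sub>0 x e)" if "j \<in> ?J" for j
      using that Suc.prems(3)[of n] by (auto intro!: polyfun_frozen_bound split: prod.split)
    have sub: "h ` {\<theta>. g \<theta> = g \<theta>\<^sub>0} \<subseteq> range ?s" using eq by auto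
    have fin: "finite (range ?s)"
      by (rule finite_subset[of _ "Pow ?J"]) (use J in auto)
    have "card (h ` {\<theta>. g \<theta> = g \<theta>\<^sub>0}) \<le> card (range ?s)" by (rule card_mono[OF fin sub])
    also have "\<dots> \<le> (card I * (2 * (card ?J * D) + 4) + 1) ^ card I"
      by (rule card_sign_patterns_of_polyfuns[OF assms(1) J poly])
    also have "\<dots> \<le> ?B"
      using Suc.prems(2)[of n]
      by (intro power_mono add_mono mult_le_mono) (auto simp: card_cartesian_product)
    finally show ?thesis using finite_subset[OF sub fin] by blast
  qed
  have fin_gh: "finite (range (\<lambda>\<theta>. (g \<theta>, h \<theta>)))"
    by (rule finite_subset[of _ "range g \<times> Pow (X \<times> G n)"])
      (use fin_g assms(2) Suc.prems(1) in \<open>auto simp: h_def\<close>)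
  have "range (\<lambda>\<theta>. {(x, e) \<in> X \<times> (\<Union>l<Suc n. G l). eval \<theta> x e > 0})
      = (\<lambda>(u, v). u \<union> v) ` range (\<lambda>\<theta>. (g \<theta>, h \<theta>))"
    unfolding image_image by (intro image_cong) (auto simp: g_def h_def lessThan_Suc)
  then have "card (range (\<lambda>\<theta>. {(x, e) \<in> X \<times> (\<Union>l<Suc n. G l). eval \<theta> x e > 0}))
      \<le> card (range (\<lambda>\<theta>. (g \<theta>, h \<theta>)))"
    using card_image_le[OF fin_gh] by simp
  also have "\<dots> \<le> card (range g) * ?B" by (rule card_range_pair_le[OF fin_g fibre])
  also have "\<dots> \<le> ?B ^ n * ?B" by (intro mult_right_mono IH) simp
  finally show ?case by (simp add: mult.commute)
qed

section \<open>Pre-activations of a network\<close>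

text \<open>
  The argument of the activation function in component \<open>i\<close> of layer \<open>l + 1\<close>. For
  \<open>l = L + L\<^sub>0\<close> and \<open>i = 1\<close> the last branch is the affine output of the network.
\<close>

definition preact :: "cnn_arch \<Rightarrow> nat \<Rightarrow> nat \<Rightarrow> expr" where
  "preact A l i =
     (if Suc l \<le> conv_depth A then conv A (Suc l) (layer A l) i
      else if l = conv_depth A then
        affine A (Suc l) (width A l div input_dim A) (\<lambda>j. layer A l (j * input_dim A)) i
      else affine A (Suc l) (width A l) (layer A l) i)"

lemma layer_Suc_eq_Act:
  "layer A (Suc l) i = Act (if l = conv_depth A then relu_exp A else 1) 0 (preact A l i)"
  by (simp add: preact_def)

declare layer.simps(2) [simp del] width.simps(2) [simp del]

lemma cnn_output_eq_preact:
  "fc_depth A \<ge> 1 \<Longrightarrow> cnn_output A = preact A (conv_depth A + fc_depth A) 1"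
  by (simp add: cnn_output_def preact_def Let_def)

lemma gates_esum: "gates (esum f n) = (\<Union>j\<in>{1..n}. gates (f j))"
  by (induction n) (auto simp: atLeastAtMostSuc_conv)

lemma params_esum: "params (esum f n) = (\<Union>j\<in>{1..n}. params (f j))"
  by (induction n) (auto simp: atLeastAtMostSuc_conv)

lemma pos_exps_esum: "pos_exps (esum f n) \<longleftrightarrow> (\<forall>j\<in>{1..n}. pos_exps (f j))"
  by (induction n) (auto simp: atLeastAtMostSuc_conv)

lemma deg_esum_le: "(\<And>j. j \<in> {1..n} \<Longrightarrow> deg (f j) \<le> b) \<Longrightarrow> b \<ge> 0 \<Longrightarrow> deg (esum f n) \<le> b"
  by (induction n) auto

lemma entry_properties:
  "gates (entry A z) = {}" "params (entry A z) = set_option (sharing A z)"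
  "pos_exps (entry A z)" "deg (entry A z) \<le> 1"
  by (auto simp: entry_def split: option.split)

lemma kernel_properties:
  "gates (kernel A l t) = {}" "pos_exps (kernel A l t)" "deg (kernel A l t) \<le> 1"
  by (auto simp: kernel_def entry_properties)

lemma sampled_index_le_width:
  "j \<in> {1..w div d} \<Longrightarrow> d \<ge> 2 \<Longrightarrow> j * d \<in> {1..w}" for j w d :: nat
  by (auto simp: less_eq_div_iff_mult_less_eq)

lemma gates_preact:
  assumes "input_dim A \<ge> 2"
  shows "gates (preact A l i) \<subseteq> (\<Union>j\<in>{1..width A l}. gates (layer A l j))"
proof -
  let ?U = "\<Union>j\<in>{1..width A l}. gates (layer A l j)"
  have "gates (conv A (Suc l) (layer A l) i) \<subseteq> ?U"
    by (simp add: conv_def gates_esum entry_properties kernel_properties)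
  moreover have "gates (layer A l (j * input_dim A)) \<subseteq> ?U"
    if "j \<in> {1..width A l div input_dim A}" for j
    using sampled_index_le_width[OF that assms] by (rule UN_upper)
  then have "gates (affine A (Suc l) (width A l div input_dim A)
      (\<lambda>j. layer A l (j * input_dim A)) i) \<subseteq> ?U"
    by (simp add: affine_def gates_esum entry_properties UN_subset_iff)
  moreover have "gates (affine A (Suc l) (width A l) (layer A l) i) \<subseteq> ?U"
    by (simp add: affine_def gates_esum entry_properties)
  ultimately show ?thesis
    by (cases "Suc l \<le> conv_depth A"; cases "l = conv_depth A"; simp only: preact_def if_True if_False simp_thms)
qed

lemma pos_exps_layer: "relu_exp A \<ge> 1 \<Longrightarrow> pos_exps (layer A l i)"
  by (induction l arbitrary: i)
    (auto simp: layer.simps(2) conv_def affine_def pos_exps_esum entry_properties kernel_properties)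

lemma pos_exps_preact: "relu_exp A \<ge> 1 \<Longrightarrow> pos_exps (preact A l i)"
  using pos_exps_layer[of A "Suc l" i] by (simp add: layer_Suc_eq_Act)

lemma deg_weighted_sum_le:
  assumes "\<And>j. deg (u j) \<le> 1" "\<And>j. deg (z j) \<le> b" "b \<ge> 0"
  shows "deg (esum (\<lambda>j. Mul (u j) (z j)) n) \<le> b + 1"
  using add_mono[OF assms(2,1)] assms(3) by (intro deg_esum_le) (auto simp: add.commute)

lemma deg_preact_le:
  assumes "\<And>j. deg (layer A l j) \<le> b" "b \<ge> 0"
  shows "deg (preact A l i) \<le> b + 1"
proof -
  have "deg (entry A z) \<le> b + 1" for z using entry_properties(4)[of A z] assms(2) by linarith
  then show ?thesis unfolding preact_def conv_def affine_def
    using assms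
    by (cases "l = conv_depth A") (auto simp: deg_weighted_sum_le entry_properties kernel_properties)
qed

lemma deg_conv_layer_le: "l \<le> conv_depth A \<Longrightarrow> deg (layer A l i) \<le> int l"
proof (induction l arbitrary: i)
  case (Suc l)
  have "deg (preact A l i) \<le> int l + 1"
    by (rule deg_preact_le) (use Suc in auto)
  with Suc.prems show ?case by (simp add: layer_Suc_eq_Act)
qed simp

text \<open>
  The exponent \<open>k\<close> multiplies the degree once, in layer \<open>L + 1\<close>, where the pre-activations have degree at
  most \<open>L + 1\<close>. Afterwards the degree grows by at most one per layer.
\<close>

lemma deg_fc_layer_le:
  "relu_exp A \<ge> 1 \<Longrightarrow> l \<ge> conv_depth A + 1 \<Longrightarrow> deg (layer A l i) \<le> int (relu_exp A * l)"
proof (induction l arbitrary: i)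
  case (Suc l)
  show ?case
  proof (cases "l = conv_depth A")
    case True
    have "deg (preact A l i) \<le> int l + 1"
      by (rule deg_preact_le) (use True deg_conv_layer_le in auto)
    then have "int (relu_exp A) * deg (preact A l i) \<le> int (relu_exp A) * (int l + 1)"
      by (intro mult_left_mono) auto
    with True show ?thesis by (simp add: layer_Suc_eq_Act algebra_simps)
  next
    case False
    have "deg (preact A l i) \<le> int (relu_exp A * l) + 1"
      by (rule deg_preact_le) (use False Suc in auto)
    with False Suc.prems show ?thesis
      by (simp add: layer_Suc_eq_Act algebra_simps)
  qed
qed simp

lemma deg_preact:
  assumes "relu_exp A \<ge> 1"
  shows "deg (preact A l i) \<le> int (relu_exp A * (l + 1))"
proof -
  have "deg (layer A l j) \<le> int (relu_exp A * l)" for j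
  proof (cases "l \<le> conv_depth A")
    case True
    then have "deg (layer A l j) \<le> int l" by (rule deg_conv_layer_le)
    also have "\<dots> \<le> int (relu_exp A * l)" using assms by (cases "relu_exp A") auto
    finally show ?thesis .
  qed (use deg_fc_layer_le[OF assms] in auto)
  then have "deg (preact A l i) \<le> int (relu_exp A * l) + 1" by (rule deg_preact_le) simp
  with assms show ?thesis by simp
qed

section \<open>Counting the parameters and the sign patterns of a network\<close>

text \<open>
  A finite range that contains all positions read by the network when the widths and the kernel size
  are at most \<open>W\<close>. It serves to bound the number of occurring parameters by the size of the network.
\<close>

definition slots :: "cnn_arch \<Rightarrow> nat \<Rightarrow> slot set" where
  "slots A W =
     (\<lambda>(l, t). Kernel l t) ` ({1..conv_depth A + fc_depth A + 1} \<times> {..<W}) \<union>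
     (\<lambda>(l, i, j). Weight l i j) ` ({1..conv_depth A + fc_depth A + 1} \<times> {1..W} \<times> {1..W}) \<union>
     (\<lambda>(l, i). Bias l i) ` ({1..conv_depth A + fc_depth A + 1} \<times> {1..W})"

definition used_params :: "cnn_arch \<Rightarrow> nat \<Rightarrow> nat set" where
  "used_params A W = {p. Some p \<in> sharing A ` slots A W}"

lemma finite_slots: "finite (slots A W)"
  by (simp add: slots_def)

lemma card_slots: "card (slots A W) \<le> (conv_depth A + fc_depth A + 1) * (W\<^sup>2 + 2 * W)"
proof -
  let ?n = "conv_depth A + fc_depth A + 1"
  have "card (slots A W) \<le> ?n * W + ?n * (W * W) + ?n * W"
    unfolding slots_def
    by (rule order_trans[OF card_Un_le] add_mono order_trans[OF card_image_le] | simp)+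
  then show ?thesis by (simp add: power2_eq_square algebra_simps)
qed

lemma card_used_params_le_slots: "card (used_params A W) \<le> card (slots A W)"
proof -
  have "card (used_params A W) = card (Some ` used_params A W)" by (simp add: card_image)
  also have "\<dots> \<le> card (sharing A ` slots A W)"
    using finite_slots by (intro card_mono) (auto simp: used_params_def)
  also have "\<dots> \<le> card (slots A W)" by (rule card_image_le[OF finite_slots])
  finally show ?thesis .
qed

lemma used_params_subset: "cnn_arch_wf A \<Longrightarrow> used_params A W \<subseteq> {..<num_params A}"
  unfolding used_params_def cnn_arch_wf_def by (metis (mono_tags, lifting) imageE lessThan_iff mem_Collect_eq subsetI)

lemma params_entry_used:
  assumes "z \<in> slots A W"
  shows "params (entry A z) \<subseteq> used_params A W"
proof
  fix p assume "p \<in> params (entry A z)"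
  then have "Some p = sharing A z" by (cases "sharing A z") (auto simp: entry_properties)
  with assms show "p \<in> used_params A W" unfolding used_params_def by auto
qed

lemma params_kernel_used:
  assumes "l \<in> {1..conv_depth A + fc_depth A + 1}" "kernel_size A \<le> W"
  shows "params (kernel A l t) \<subseteq> used_params A W"
proof (cases "0 \<le> t \<and> t < int (kernel_size A)")
  case True
  then have "nat t < W" using assms(2) by linarith
  then have "Kernel l (nat t) \<in> slots A W" using assms(1) by (auto simp: slots_def)
  with True params_entry_used show ?thesis by (simp add: kernel_def)
qed (auto simp: kernel_def)

lemma params_preact_used:
  assumes A: "input_dim A \<ge> 2" "kernel_size A \<le> W"
    and W: "\<And>l. l \<le> conv_depth A + fc_depth A \<Longrightarrow> width A l \<le> W"
  shows "l \<le> conv_depth A + fc_depth A \<Longrightarrow> i \<in> {1..W} \<Longrightarrow> params (preact A l i) \<subseteq> used_params A W"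
proof (induction l arbitrary: i)
  have step: "params (preact A l i) \<subseteq> used_params A W"
    if l: "l \<le> conv_depth A + fc_depth A" and i: "i \<in> {1..W}"
      and layer: "\<And>j. j \<in> {1..width A l} \<Longrightarrow> params (layer A l j) \<subseteq> used_params A W" for l i
  proof -
    have bias: "params (entry A (Bias (Suc l) i)) \<subseteq> used_params A W"
      using l i by (intro params_entry_used) (auto simp: slots_def)
    have weight: "params (entry A (Weight (Suc l) i j)) \<subseteq> used_params A W"
      if "j \<in> {1..width A l}" for j
      using l i that W[OF l] by (intro params_entry_used) (auto simp: slots_def image_iff)
    have weight': "params (entry A (Weight (Suc l) i j)) \<subseteq> used_params A W"
      if "j \<in> {1..width A l div input_dim A}" for j
    proof (rule weight)
      show "j \<in> {1..width A l}"
        using that by (meson atLeastAtMost_iff div_le_dividend le_trans)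
    qed
    have kernel: "params (kernel A (Suc l) t) \<subseteq> used_params A W" for t
      using l A(2) by (intro params_kernel_used) auto
    have sampled: "params (layer A l (j * input_dim A)) \<subseteq> used_params A W"
      if "j \<in> {1..width A l div input_dim A}" for j
      by (rule layer[OF sampled_index_le_width[OF that A(1)]])
    have "params (conv A (Suc l) (layer A l) i) \<subseteq> used_params A W"
      using bias kernel layer by (simp add: conv_def params_esum UN_subset_iff)
    moreover have "params (affine A (Suc l) (width A l div input_dim A)
        (\<lambda>j. layer A l (j * input_dim A)) i) \<subseteq> used_params A W"
      using bias weight' sampled by (simp add: affine_def params_esum UN_subset_iff)
    moreover have "params (affine A (Suc l) (width A l) (layer A l) i) \<subseteq> used_params A W"
      using bias weight layer by (simp add: affine_def params_esum UN_subset_iff)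
    ultimately show ?thesis
      by (cases "Suc l \<le> conv_depth A"; cases "l = conv_depth A"; simp only: preact_def if_True if_False simp_thms)
  qed
  {
    case 0
    then show ?case by (intro step) auto
  next
    case (Suc l)
    show ?case
    proof (rule step[OF Suc.prems])
      fix j assume "j \<in> {1..width A (Suc l)}"
      with W[OF Suc.prems(1)] have "j \<in> {1..W}" by auto
      with Suc show "params (layer A (Suc l) j) \<subseteq> used_params A W"
        by (simp add: layer_Suc_eq_Act)
    qed
  }
qed

lemma gates_preact_layered:
  assumes "input_dim A \<ge> 2"
  shows "gates (preact A l i) \<subseteq> (\<Union>l'<l. preact A l' ` {1..width A (Suc l')})"
proof (induction l arbitrary: i)
  case 0
  then show ?case using gates_preact[OF assms, of 0 i] by simp
next
  case (Suc l)
  have "gates (layer A (Suc l) j) \<subseteq> (\<Union>l'<Suc l. preact A l' ` {1..width A (Suc l')})"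
    if "j \<in> {1..width A (Suc l)}" for j
  proof -
    have "preact A l j \<in> (\<Union>l'<Suc l. preact A l' ` {1..width A (Suc l')})"
      using that by (intro UN_I[of l]) auto
    moreover have "gates (preact A l j) \<subseteq> (\<Union>l'<Suc l. preact A l' ` {1..width A (Suc l')})"
      by (rule order_trans[OF Suc.IH]) (intro UN_mono, auto)
    ultimately show ?thesis by (simp only: layer_Suc_eq_Act gates.simps insert_subset)
  qed
  then have "(\<Union>j\<in>{1..width A (Suc l)}. gates (layer A (Suc l) j))
      \<subseteq> (\<Union>l'<Suc l. preact A l' ` {1..width A (Suc l')})" by (rule UN_least)
  with gates_preact[OF assms] show ?case by (rule order_trans)
qed

definition max_width :: "cnn_arch \<Rightarrow> nat" where
  "max_width A = Max (width A ` {1..conv_depth A + fc_depth A})"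

lemma width_le_max_width:
  assumes "cnn_arch_wf A" "l \<le> conv_depth A + fc_depth A"
  shows "width A l \<le> max_width A"
proof -
  have *: "width A l \<le> max_width A" if "1 \<le> l" "l \<le> conv_depth A + fc_depth A" for l
    unfolding max_width_def using that by (intro Max_ge) auto
  have "width A 0 \<le> width A 1"
    using assms(1) by (auto simp: cnn_arch_wf_def width.simps(2))
  also have "\<dots> \<le> max_width A" using assms(1) by (intro *) (auto simp: cnn_arch_wf_def)
  finally show ?thesis using *[of l] assms(2) by (cases "l = 0") auto
qed

lemma max_width_lower_bounds:
  assumes "cnn_arch_wf A"
  shows "kernel_size A \<le> max_width A" "max_width A \<ge> 4"
proof -
  have "width A 1 \<le> max_width A"
    using assms by (intro width_le_max_width) (auto simp: cnn_arch_wf_def)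
  moreover have "width A 1 = input_dim A + kernel_size A - 1"
    using assms by (simp add: cnn_arch_wf_def width.simps(2))
  ultimately show "kernel_size A \<le> max_width A" "max_width A \<ge> 4"
    using assms by (auto simp: cnn_arch_wf_def)
qed

text \<open>
  The layers of the counting argument are the \<open>\<Lambda>\<close> layers of pre-activations and, as layer number \<open>\<Lambda>\<close>,
  the derivative \<open>e\<close> of the output.
\<close>

lemma card_cnn_deriv_sign_patterns:
  assumes wf: "cnn_arch_wf A" and "relu_exp A \<ge> 1" and "finite X"
  defines "\<Lambda> \<equiv> conv_depth A + fc_depth A" and "W \<equiv> max_width A"
  defines "p \<equiv> card (used_params A W)"
  shows "card (range (\<lambda>\<theta>. {x \<in> X. cnn_deriv A \<alpha> \<theta> x > 0}))
    \<le> ((p * (2 * (card X * W * (relu_exp A * (\<Lambda> + 1))) + 4) + 1) ^ p) ^ (\<Lambda> + 1)"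
proof -
  let ?D = "relu_exp A * (\<Lambda> + 1)"
  define e where "e = deriv_mi (input_dim A) \<alpha> (cnn_output A)"
  define G where "G l = (if l < \<Lambda> then preact A l ` {1..width A (Suc l)} else {e})" for l
  have dims: "input_dim A \<ge> 2" "fc_depth A \<ge> 1" using wf by (auto simp: cnn_arch_wf_def)
  have W: "kernel_size A \<le> W" "W \<ge> 4"
    using max_width_lower_bounds[OF wf] by (auto simp: W_def)
  have width: "width A l \<le> W" if "l \<le> \<Lambda>" for l
    unfolding W_def by (rule width_le_max_width[OF wf]) (use that in \<open>simp add: \<Lambda>_def\<close>)
  have out: "cnn_output A = preact A \<Lambda> 1"
    unfolding \<Lambda>_def by (rule cnn_output_eq_preact[OF dims(2)])
  have preact: "pos_exps (preact A l i) \<and> params (preact A l i) \<subseteq> used_params A W \<and>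
      deg (preact A l i) \<le> int ?D" if "l \<le> \<Lambda>" "i \<in> {1..W}" for l i
  proof (intro conjI)
    show "pos_exps (preact A l i)" by (rule pos_exps_preact[OF assms(2)])
    show "params (preact A l i) \<subseteq> used_params A W"
      by (rule params_preact_used) (use dims W width that in \<open>auto simp: \<Lambda>_def\<close>)
    have "int (relu_exp A * (l + 1)) \<le> int ?D" using that(1) by (intro of_nat_mono mult_left_mono) auto
    with deg_preact[OF assms(2), of l i] show "deg (preact A l i) \<le> int ?D" by (rule order_trans)
  qed
  have e: "pos_exps e \<and> params e \<subseteq> used_params A W \<and> deg e \<le> int ?D"
    "gates e \<subseteq> gates (preact A \<Lambda> 1)"
    using preact[of \<Lambda> 1] W(2) deriv_mi_properties[of "preact A \<Lambda> 1" "input_dim A" \<alpha>]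
    unfolding e_def out by auto
  have pattern: "card (range (\<lambda>\<theta>. {(x, a) \<in> X \<times> (\<Union>l<\<Lambda> + 1. G l). eval \<theta> x a > 0}))
      \<le> ((p * (2 * (card X * W * ?D) + 4) + 1) ^ p) ^ (\<Lambda> + 1)"
    unfolding p_def
  proof (rule card_layered_gate_patterns)
    show "finite (used_params A W)"
      using used_params_subset[OF wf] finite_subset by blast
    show "card (G l) \<le> W" for l
    proof (cases "l < \<Lambda>")
      case True
      have "card (preact A l ` {1..width A (Suc l)}) \<le> width A (Suc l)"
        using card_image_le[of "{1..width A (Suc l)}"] by simp
      also have "\<dots> \<le> W" using True by (intro width) simp
      finally show ?thesis using True by (simp add: G_def)
    qed (use W(2) in \<open>simp add: G_def\<close>)
    show "pos_exps a \<and> params a \<subseteq> used_params A W \<and> deg a \<le> int ?D" if "a \<in> G l" for l a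
    proof (cases "l < \<Lambda>")
      case True
      then obtain i where "a = preact A l i" "i \<in> {1..width A (Suc l)}"
        using \<open>a \<in> G l\<close> by (auto simp: G_def)
      then show ?thesis using True width[of "Suc l"] preact[of l i] by auto
    qed (use that e(1) in \<open>simp add: G_def\<close>)
    show "gates a \<subseteq> (\<Union>l'<l. G l')" if "l < \<Lambda> + 1" "a \<in> G l" for l a
    proof -
      have "gates a \<subseteq> (\<Union>l'<l. preact A l' ` {1..width A (Suc l')})"
      proof (cases "l < \<Lambda>")
        case True
        then obtain i where "a = preact A l i" using \<open>a \<in> G l\<close> by (auto simp: G_def)
        then show ?thesis using gates_preact_layered[OF dims(1), of l i] by (simp only:)
      next
        case False
        then have "l = \<Lambda>" "a = e" using that by (auto simp: G_def)
        then show ?thesis using order_trans[OF e(2) gates_preact_layered[OF dims(1)]] by (simp only:)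
      qed
      also have "\<dots> = (\<Union>l'<l. G l')" using that(1) by (intro SUP_cong) (auto simp: G_def)
      finally show ?thesis .
    qed
  qed (auto simp: \<open>finite X\<close> G_def)
  define U where "U = (\<Union>l<\<Lambda> + 1. G l)"
  have "finite U" by (auto simp: U_def G_def)
  have "e \<in> U" unfolding U_def by (rule UN_I[of \<Lambda>]) (auto simp: G_def)
  then have last_layer: "{x \<in> X. (x, e) \<in> {(x, a) \<in> X \<times> U. eval \<theta> x a > 0}}
      = {x \<in> X. cnn_deriv A \<alpha> \<theta> x > 0}" for \<theta>
    by (auto simp: cnn_deriv_def e_def)
  have "finite (range (\<lambda>\<theta>. {(x, a) \<in> X \<times> U. eval \<theta> x a > 0}))"
    by (rule finite_subset[of _ "Pow (X \<times> U)"]) (auto simp: \<open>finite X\<close> \<open>finite U\<close>)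
  from card_image_le[OF this, of "\<lambda>S. {x \<in> X. (x, e) \<in> S}"]
  have "card (range (\<lambda>\<theta>. {x \<in> X. cnn_deriv A \<alpha> \<theta> x > 0}))
      \<le> card (range (\<lambda>\<theta>. {(x, a) \<in> X \<times> U. eval \<theta> x a > 0}))"
    unfolding image_image last_layer .
  with pattern show ?thesis unfolding U_def by (rule order_trans[rotated])
qed

section \<open>The bound on the Vapnik--Chervonenkis dimension\<close>

lemma ln_le_linear: "x > 0 \<Longrightarrow> a > 0 \<Longrightarrow> ln x \<le> ln a + x / a" for x a :: real
  using ln_le_minus_one[of "x / a"] by (simp add: ln_div)

text \<open>
  With \<open>Z = k \<Lambda> W\<close> the base of the power is at most \<open>m Z\<^sup>5\<close>, so \<open>m \<lesssim> p \<Lambda> (log m + log Z)\<close>. The term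
  \<open>log m\<close> is removed by the tangent estimate \<open>log m \<le> log (4 q) + m / (4 q)\<close> with \<open>q = 2 p \<Lambda>\<close>: its linear
  part costs only \<open>m / 4\<close>, and \<open>4 q\<close> is again at most \<open>Z\<^sup>5\<close>.
\<close>

lemma shattering_inequality_solved:
  fixes m p \<Lambda> W k :: nat
  assumes count: "2 ^ m \<le> ((p * (2 * (m * W * (k * (\<Lambda> + 1))) + 4) + 1) ^ p) ^ (\<Lambda> + 1)"
    and p: "p \<le> (\<Lambda> + 1) * (W\<^sup>2 + 2 * W)"
    and "W \<ge> 4" "\<Lambda> \<ge> 2" "k \<ge> 1"
  shows "real m \<le> 80 * real p * real \<Lambda> * ln (real (k * \<Lambda> * W))"
proof (cases "p = 0 \<or> m = 0")
  case True
  moreover have "m = 0" if "p = 0"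
  proof -
    have "(2 :: nat) ^ m \<le> 2 ^ 0" using count that by simp
    then show ?thesis by (subst (asm) power_increasing_iff) auto
  qed
  moreover have "ln (real (k * \<Lambda> * W)) \<ge> 0"
  proof -
    have "1 * 1 * 1 \<le> k * \<Lambda> * W" using assms(3-5) by (intro mult_le_mono) auto
    then show ?thesis by (intro ln_ge_zero) linarith
  qed
  ultimately show ?thesis by auto
next
  case False
  define Z where "Z = k * \<Lambda> * W"
  have "1 * 2 * 4 \<le> k * \<Lambda> * W" by (intro mult_le_mono assms)
  then have Z: "Z \<ge> 8" by (simp add: Z_def)
  have \<Lambda>: "\<Lambda> + 1 \<le> 2 * \<Lambda>" using assms(4) by simp
  have WZ: "\<Lambda> * W \<le> Z" using assms(5) by (cases k) (auto simp: Z_def)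
  have "W * (k * (\<Lambda> + 1)) \<le> W * (k * (2 * \<Lambda>))" by (intro mult_le_mono \<Lambda>) auto
  then have deg: "W * (k * (\<Lambda> + 1)) \<le> 2 * Z" by (simp add: Z_def algebra_simps)
  have pZ: "p \<le> 4 * Z\<^sup>2" "p * \<Lambda> \<le> 4 * Z ^ 3"
  proof -
    have "p \<le> 2 * \<Lambda> * (2 * W\<^sup>2)"
    proof (rule order_trans[OF p], rule mult_le_mono[OF \<Lambda>])
      show "W\<^sup>2 + 2 * W \<le> 2 * W\<^sup>2" using assms(3) by (simp add: power2_eq_square)
    qed
    then have 1: "p \<le> 4 * (\<Lambda> * W * W)" by (simp add: power2_eq_square algebra_simps)
    also have "\<dots> \<le> 4 * (\<Lambda> * W * (\<Lambda> * W))"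
      using assms(4) by (intro mult_le_mono) auto
    also have "\<dots> \<le> 4 * (Z * Z)" by (intro mult_le_mono WZ) auto
    finally show "p \<le> 4 * Z\<^sup>2" by (simp add: power2_eq_square)
    have "p * \<Lambda> \<le> 4 * (\<Lambda> * W * W) * \<Lambda>" by (intro mult_le_mono 1) auto
    also have "\<dots> = 4 * (\<Lambda> * W * (\<Lambda> * W))" by (simp add: algebra_simps)
    also have "\<dots> \<le> 4 * (Z * Z)" by (intro mult_le_mono WZ) auto
    also have "\<dots> \<le> 4 * (Z * Z * Z)" using Z by (intro mult_le_mono) auto
    finally show "p * \<Lambda> \<le> 4 * Z ^ 3" by (simp add: power3_eq_cube)
  qed
  have "m * W * (k * (\<Lambda> + 1)) \<le> m * (2 * Z)" using deg by (metis mult.assoc mult_le_mono2)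
  then have "2 * (m * W * (k * (\<Lambda> + 1))) + 4 \<le> 2 * (m * (2 * Z)) + 4" by linarith
  from mult_le_mono[OF pZ(1) this]
  have "p * (2 * (m * W * (k * (\<Lambda> + 1))) + 4) + 1 \<le> 4 * Z\<^sup>2 * (2 * (m * (2 * Z)) + 4) + 1"
    by (rule add_le_mono1)
  also have "\<dots> \<le> m * Z ^ 5"
  proof -
    have m: "m \<ge> 1" using False by simp
    have "4 \<le> 4 * (m * Z)" using m Z by (simp add: Suc_le_eq)
    then have expand: "4 * Z\<^sup>2 * (2 * (m * (2 * Z)) + 4) \<le> 4 * Z\<^sup>2 * (8 * (m * Z))"
      by (intro mult_le_mono) auto
    have "1 \<le> m * Z ^ 3" using m Z by (simp add: Suc_le_eq)
    have "4 * Z\<^sup>2 * (2 * (m * (2 * Z)) + 4) + 1 \<le> 64 * (m * Z ^ 3)"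
    proof -
      have "4 * Z\<^sup>2 * (8 * (m * Z)) = 32 * (m * Z ^ 3)"
        by (simp add: power2_eq_square power3_eq_cube algebra_simps)
      with expand \<open>1 \<le> m * Z ^ 3\<close> show ?thesis by linarith
    qed
    also have "64 \<le> Z\<^sup>2" using power_mono[OF Z, of 2] by simp
    then have "64 * (m * Z ^ 3) \<le> Z\<^sup>2 * (m * Z ^ 3)" by (intro mult_le_mono) auto
    also have "\<dots> = m * Z ^ 5" by (simp add: power_add[symmetric] algebra_simps)
    finally show ?thesis .
  qed
  finally have "2 ^ m \<le> ((m * Z ^ 5) ^ p) ^ (\<Lambda> + 1)"
    using count by (meson le_trans power_mono zero_le)
  also have "\<dots> = (m * Z ^ 5) ^ (p * (\<Lambda> + 1))" by (rule power_mult[symmetric])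
  also have "\<dots> \<le> (m * Z ^ 5) ^ (p * (2 * \<Lambda>))"
    using False Z \<Lambda> by (intro power_increasing) auto
  finally have "real (2 ^ m) \<le> real ((m * Z ^ 5) ^ (p * (2 * \<Lambda>)))" by (rule of_nat_mono)
  then have "ln (2 ^ m) \<le> ln ((real m * real Z ^ 5) ^ (p * (2 * \<Lambda>)))"
    using False Z by (subst ln_le_cancel_iff) auto
  define q where "q = real (p * (2 * \<Lambda>))"
  define z where "z = ln (real Z)"
  have q: "q > 0" using False assms(4) by (simp add: q_def)
  have "real m * ln 2 \<le> q * (ln (real m) + 5 * z)"
    using \<open>ln (2 ^ m) \<le> _\<close> False Z
    by (simp add: q_def z_def ln_realpow ln_mult)
  moreover have "ln (real m) \<le> 5 * z + real m / (4 * q)"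
  proof -
    have "4 * q \<le> real (Z ^ 5)"
    proof -
      have "8 * (p * \<Lambda>) \<le> 8 * (4 * Z ^ 3)" by (intro mult_le_mono2 pZ(2))
      also have "\<dots> \<le> 64 * Z ^ 3" by simp
      also have "\<dots> \<le> Z\<^sup>2 * Z ^ 3" using power_mono[OF Z, of 2] by (intro mult_le_mono1) simp
      also have "\<dots> = Z ^ 5" by (simp add: power_add[symmetric])
      finally have "real (8 * (p * \<Lambda>)) \<le> real (Z ^ 5)" by (rule of_nat_mono)
      then show ?thesis by (simp add: q_def)
    qed
    then have "ln (4 * q) \<le> ln (real (Z ^ 5))" using q Z by (subst ln_le_cancel_iff) auto
    also have "\<dots> = 5 * z" using Z by (simp add: z_def ln_realpow)
    finally show ?thesis using ln_le_linear[of "real m" "4 * q"] False q by auto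
  qed
  ultimately have "real m * ln 2 \<le> q * (5 * z + real m / (4 * q) + 5 * z)"
    using q by (smt (verit) mult_left_mono)
  also have "\<dots> = 10 * q * z + real m / 4" using q by (simp add: field_simps)
  finally have "real m * ln 2 \<le> 10 * q * z + real m / 4" .
  moreover have "real m * (1 / 2) \<le> real m * ln 2"
    using ln_le_minus_one[of "1 / 2"] by (intro mult_left_mono) (auto simp: ln_div)
  ultimately have "real m \<le> 40 * q * z" by simp
  then show ?thesis by (simp add: q_def z_def Z_def algebra_simps)
qed

lemma log_factor_nonneg:
  assumes "cnn_arch_wf A" "relu_exp A \<ge> 1"
  shows "ln (real (relu_exp A * (conv_depth A + fc_depth A) * max_width A)) \<ge> 0"
proof -
  have "relu_exp A * (conv_depth A + fc_depth A) * max_width A \<ge> 1"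
    using assms max_width_lower_bounds(2)[OF assms(1)] by (simp add: cnn_arch_wf_def Suc_le_eq)
  then show ?thesis by (intro ln_ge_zero) linarith
qed

text \<open>
  Restricting the parameters to the admissible ones only loses patterns, so all patterns over all
  parameter vectors are counted.
\<close>

lemma card_shattered_by_cnn_deriv:
  assumes wf: "cnn_arch_wf A" and k: "relu_exp A \<ge> 1" and "finite X"
    and X: "X \<subseteq> unit_sphere (input_dim A)"
    and shattered: "card ((\<lambda>h. restrict h X) ` step_class (cnn_deriv_class A s M \<alpha>)) = 2 ^ card X"
  shows "real (card X) \<le> 80 * real (num_params A) * real (conv_depth A + fc_depth A) *
    ln (real (relu_exp A * (conv_depth A + fc_depth A) * max_width A))"
proof -
  define W \<Lambda> where "W = max_width A" and "\<Lambda> = conv_depth A + fc_depth A"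
  define p where "p = card (used_params A W)"
  let ?r = "\<lambda>\<theta>. {x \<in> X. cnn_deriv A \<alpha> \<theta> x > 0}"
  have "finite (range ?r)"
    by (rule finite_subset[of _ "Pow X"]) (auto simp: \<open>finite X\<close>)
  moreover have "(\<lambda>h. restrict h X) ` step_class (cnn_deriv_class A s M \<alpha>)
      \<subseteq> (\<lambda>S. \<lambda>x\<in>X. if x \<in> S then 1 else 0) ` range ?r"
  proof
    fix h assume "h \<in> (\<lambda>h. restrict h X) ` step_class (cnn_deriv_class A s M \<alpha>)"
    then obtain \<theta> where
      "h = restrict (\<lambda>x. step (restrict (cnn_deriv A \<alpha> \<theta>) (unit_sphere (input_dim A)) x)) X"
      by (auto simp: step_class_def cnn_deriv_class_def)
    then have "h = (\<lambda>x\<in>X. if x \<in> ?r \<theta> then 1 else 0)"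
      using X by (auto simp: step_def fun_eq_iff)
    then show "h \<in> (\<lambda>S. \<lambda>x\<in>X. if x \<in> S then 1 else 0) ` range ?r" by blast
  qed
  ultimately have "2 ^ card X \<le> card (range ?r)"
    unfolding shattered[symmetric] by (rule surj_card_le)
  also have "\<dots> \<le> ((p * (2 * (card X * W * (relu_exp A * (\<Lambda> + 1))) + 4) + 1) ^ p) ^ (\<Lambda> + 1)"
    unfolding p_def W_def \<Lambda>_def by (rule card_cnn_deriv_sign_patterns[OF wf k \<open>finite X\<close>])
  finally have "real (card X) \<le> 80 * real p * real \<Lambda> * ln (real (relu_exp A * \<Lambda> * W))"
  proof (rule shattering_inequality_solved)
    show "p \<le> (\<Lambda> + 1) * (W\<^sup>2 + 2 * W)"
      unfolding p_def \<Lambda>_def by (rule order_trans[OF card_used_params_le_slots card_slots])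
    show "W \<ge> 4" unfolding W_def by (rule max_width_lower_bounds(2)[OF wf])
    show "\<Lambda> \<ge> 2" using wf by (simp add: \<Lambda>_def cnn_arch_wf_def)
  qed (rule k)
  also have "\<dots> \<le> 80 * real (num_params A) * real \<Lambda> * ln (real (relu_exp A * \<Lambda> * W))"
  proof -
    have "p \<le> num_params A"
      using card_mono[OF _ used_params_subset[OF wf]] by (simp add: p_def)
    moreover have "ln (real (relu_exp A * \<Lambda> * W)) \<ge> 0"
      unfolding \<Lambda>_def W_def by (rule log_factor_nonneg[OF wf k])
    ultimately show ?thesis by (intro mult_right_mono mult_left_mono) auto
  qed
  finally show ?thesis by (simp only: W_def \<Lambda>_def)
qed

text \<open>
  The supremum is taken in the extended naturals, hence the detour through the floor of \<open>r\<close>.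
\<close>

lemma vc_dim_le:
  fixes D :: "'a set"
  assumes "\<And>X. finite X \<Longrightarrow> X \<subseteq> D \<Longrightarrow> card ((\<lambda>h. restrict h X) ` H) = 2 ^ card X \<Longrightarrow>
      real (card X) \<le> r"
    and "r \<ge> 0"
  shows "ereal_of_enat (vc_dim D H) \<le> ereal r"
proof -
  have "vc_dim D H \<le> enat (nat \<lfloor>r\<rfloor>)"
    unfolding vc_dim_def
  proof (rule Sup_least)
    fix n assume "n \<in> {enat (card X) |X. finite X \<and> X \<subseteq> D \<and> card ((\<lambda>h. restrict h X) ` H) = 2 ^ card X}"
    then obtain X :: "'a set" where "n = enat (card X)" "real (card X) \<le> r" using assms(1) by blast
    then show "n \<le> enat (nat \<lfloor>r\<rfloor>)" by (simp add: le_nat_floor)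
  qed
  then have "ereal_of_enat (vc_dim D H) \<le> ereal_of_enat (enat (nat \<lfloor>r\<rfloor>))"
    by (simp only: ereal_of_enat_le_iff)
  also have "\<dots> \<le> ereal r" using assms(2) by simp
  finally show ?thesis .
qed

theorem theorem3:
  shows "\<exists>C::real. C > 0 \<and>
    (\<forall>(A::cnn_arch) (s::nat) (M::real) (\<alpha>::nat \<Rightarrow> nat).
       cnn_arch_wf A \<longrightarrow> s \<ge> 1 \<longrightarrow> relu_exp A \<ge> s \<longrightarrow> order_mi (input_dim A) \<alpha> \<le> s \<longrightarrow>
       ereal_of_enat (vc_dim (unit_sphere (input_dim A)) (step_class (cnn_deriv_class A s M \<alpha>)))
       \<le> ereal (C * real (num_params A) * real (conv_depth A + fc_depth A) *
           ln (real (relu_exp A * (conv_depth A + fc_depth A) *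
                 Max (width A ` {1..conv_depth A + fc_depth A})))))"
proof (rule exI[of _ 80], intro conjI allI impI)
  fix A :: cnn_arch and s :: nat and M :: real and \<alpha> :: "nat \<Rightarrow> nat"
  assume wf: "cnn_arch_wf A" and "s \<ge> 1" "relu_exp A \<ge> s"
  then have k: "relu_exp A \<ge> 1" by simp
  let ?r = "80 * real (num_params A) * real (conv_depth A + fc_depth A) *
    ln (real (relu_exp A * (conv_depth A + fc_depth A) * max_width A))"
  have "?r \<ge> 0" using log_factor_nonneg[OF wf k] by simp
  then have "ereal_of_enat (vc_dim (unit_sphere (input_dim A)) (step_class (cnn_deriv_class A s M \<alpha>)))
      \<le> ereal ?r"
    by (intro vc_dim_le card_shattered_by_cnn_deriv[OF wf k])
  then show "ereal_of_enat (vc_dim (unit_sphere (input_dim A)) (step_class (cnn_deriv_class A s M \<alpha>)))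
      \<le> ereal (80 * real (num_params A) * real (conv_depth A + fc_depth A) *
           ln (real (relu_exp A * (conv_depth A + fc_depth A) *
                 Max (width A ` {1..conv_depth A + fc_depth A}))))"
    by (simp only: max_width_def)
qed simp

end
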